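(* Let $\mathbb{G}$ be a polarizable Carnot group of homogeneous dimension $Q\ge 3$, with homogeneous norm $N=u^{1/(2-Q)}$ associated to Folland's fundamental solution $u$ of the sub-Laplacian, and let $1<p<Q$. Then for every $\phi\in C_0^{\infty}(\mathbb{G}\setminus\{0\})$, $$\int_{\mathbb{G}} |\nabla_{\mathbb{G}} \phi|^p\, dx \;\ge\; \Big(\frac{Q-p}{p}\Big)^p \int_{\mathbb{G}} \frac{|\nabla_{\mathbb{G}} N|^p}{N^p}\,|\phi|^p\, dx .$$ Furthermore, the constant $\big(\frac{Q-p}{p}\big)^p$ is sharp, i.e. it is the largest constant for which this inequality holds for all such $\phi$.
   Context: A Carnot group is a connected, simply connected, nilpotent Lie group $\mathbb{G}\equiv(\mathbb{R}^n,\cdot)$ whose Lie algebra $\mathcal{G}$ admits a stratification $\mathcal{G}=V_1\oplus\dots\oplus V_k$ with $[V_1,V_i]=V_{i+1}$ for $1\le i\le k-1$ and $[V_1,V_k]=0$. It carries a family of automorphisms (dilations) $\delta_\lambda(x_1,\dots,x_n)=(\lambda^{\alpha_1}x_1,\dots,\lambda^{\alpha_n}x_n)$, $\lambda>0$, with integers $1=\alpha_1=\dots=\alpha_m<\alpha_{m+1}\le\dots\le\alpha_n$, $m=\dim V_1$ (the coordinates of layer $V_j$ being scaled by $\lambda^j$). The homogeneous dimension is $Q=\sum_{j=1}^k j\,\dim V_j$. Lebesgue measure $dx$ on $\mathbb{R}^n$ is a Haar measure of $\mathbb{G}$. Let $X_1,\dots,X_m$ be left invariant vector fields forming a basis of $V_1$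 with $X_j(0)=\partial_{x_j}$. The horizontal gradient is $\nabla_{\mathbb{G}}=(X_1,\dots,X_m)$, with $|\cdot|$ and $\langle\cdot,\cdot\rangle$ the Euclidean norm and inner product on $\mathbb{R}^m$, and the sub-Laplacian is $\Delta_{\mathbb{G}}=\sum_{j=1}^m X_j^2$. By a theorem of Folland, for $Q\ge3$ there is a fundamental solution $u$, i.e. $-\Delta_{\mathbb{G}}u=\delta$ (Dirac distribution at the neutral element $0$), such that $N(x):=u(x)^{1/(2-Q)}$ for $x\ne0$, $N(0):=0$, is a homogeneous norm: $N:\mathbb{G}\to[0,\infty)$ is continuous, smooth away from the origin, $N(\delta_\lambda(x))=\lambda N(x)$, $N(x^{-1})=N(x)$, and $N(x)=0$ iff $x=0$. $\mathbb{G}$ is called polarizable if this $N$ satisfies the $\infty$-sub-Laplace equation $$\Delta_{\mathbb{G},\infty}N:=\tfrac12\big\langle\nabla_{\mathbb{G}}(|\nabla_{\mathbb{G}}N|^2),\nabla_{\mathbb{G}}N\big\rangle=0\quad\text{in }\mathbb{G}\setminus\{0\}.$$ *)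

theory Defs
  imports "HOL-Analysis.Analysis"
begin

text \<open>Meant for open \<open>S\<close>, since derivatives are taken in the whole space.\<close>

primrec Ck_on :: "nat \<Rightarrow> 'a set \<Rightarrow> ('a::real_normed_vector \<Rightarrow> 'b::real_normed_vector) \<Rightarrow> bool" where
  "Ck_on 0 S f \<longleftrightarrow> continuous_on S f"
| "Ck_on (Suc k) S f \<longleftrightarrow>
     (\<forall>x\<in>S. f differentiable (at x)) \<and> (\<forall>v. Ck_on k S (\<lambda>x. frechet_derivative f (at x) v))"

definition smooth_on :: "'a set \<Rightarrow> ('a::real_normed_vector \<Rightarrow> 'b::real_normed_vector) \<Rightarrow> bool" where
  "smooth_on S f \<longleftrightarrow> (\<forall>k. Ck_on k S f)"

text \<open>\<open>C\<^sub>0\<^sup>\<infinity>(\<Omega>)\<close>, its elements being extended by zero to the whole space.\<close>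

definition test_function :: "(real^'n) set \<Rightarrow> (real^'n \<Rightarrow> real) \<Rightarrow> bool" where
  "test_function \<Omega> \<phi> \<longleftrightarrow>
     smooth_on UNIV \<phi> \<and> compact (closure {x. \<phi> x \<noteq> 0}) \<and> closure {x. \<phi> x \<noteq> 0} \<subseteq> \<Omega>"

definition vf_apply :: "(real^'n \<Rightarrow> real^'n) \<Rightarrow> (real^'n \<Rightarrow> real) \<Rightarrow> real^'n \<Rightarrow> real" where
  "vf_apply X f x = frechet_derivative f (at x) (X x)"

text \<open>Coefficients of the commutator: \<open>[X,Y]f = X(Yf) - Y(Xf)\<close>.\<close>

definition vf_bracket :: "(real^'n \<Rightarrow> real^'n) \<Rightarrow> (real^'n \<Rightarrow> real^'n) \<Rightarrow> real^'n \<Rightarrow> real^'n" where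
  "vf_bracket X Y x =
     frechet_derivative Y (at x) (X x) - frechet_derivative X (at x) (Y x)"

text \<open>Groups on \<open>\<real>\<^sup>n\<close> have neutral element \<open>0\<close>.  The left invariant vector field with
  value \<open>v\<close> at \<open>0\<close> is the differential at \<open>0\<close> of left translation by \<open>x\<close>, applied to \<open>v\<close>.
  The Lie algebra is identified with the tangent space \<open>\<real>\<^sup>n\<close> at \<open>0\<close>, so that \<open>[v,w]\<close> is
  the value at \<open>0\<close> of the commutator of the corresponding left invariant fields.\<close>

definition left_field :: "(real^'n \<Rightarrow> real^'n \<Rightarrow> real^'n) \<Rightarrow> real^'n \<Rightarrow> real^'n \<Rightarrow> real^'n" where
  "left_field gmul v x = frechet_derivative (gmul x) (at 0) v"

definition lie_bracket :: "(real^'n \<Rightarrow> real^'n \<Rightarrow> real^'n) \<Rightarrow> real^'n \<Rightarrow> real^'n \<Rightarrow> real^'n" where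
  "lie_bracket gmul v w = vf_bracket (left_field gmul v) (left_field gmul w) 0"

definition bracket_span ::
  "('a \<Rightarrow> 'a \<Rightarrow> 'a) \<Rightarrow> 'a set \<Rightarrow> 'a set \<Rightarrow> 'a::real_vector set" where
  "bracket_span br A B = span {br a b | a b. a \<in> A \<and> b \<in> B}"

primrec lower_central :: "('a \<Rightarrow> 'a \<Rightarrow> 'a) \<Rightarrow> nat \<Rightarrow> 'a::real_vector set" where
  "lower_central br 0 = UNIV"
| "lower_central br (Suc j) = bracket_span br UNIV (lower_central br j)"

definition nilpotent_bracket :: "('a \<Rightarrow> 'a \<Rightarrow> 'a::real_vector) \<Rightarrow> bool" where
  "nilpotent_bracket br \<longleftrightarrow> (\<exists>j. lower_central br j = {0})"

definition direct_sum_decomposition :: "(nat \<Rightarrow> 'a::real_vector set) \<Rightarrow> nat \<Rightarrow> bool" where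
  "direct_sum_decomposition V k \<longleftrightarrow>
     (\<forall>j\<in>{1..k}. subspace (V j)) \<and>
     (\<forall>v. \<exists>!w. (\<forall>j\<in>{1..k}. w j \<in> V j) \<and> (\<forall>j. j \<notin> {1..k} \<longrightarrow> w j = 0) \<and> v = (\<Sum>j=1..k. w j))"

definition stratification ::
  "('a \<Rightarrow> 'a \<Rightarrow> 'a) \<Rightarrow> (nat \<Rightarrow> 'a::real_vector set) \<Rightarrow> nat \<Rightarrow> bool" where
  "stratification br V k \<longleftrightarrow>
     1 \<le> k \<and> direct_sum_decomposition V k \<and>
     (\<forall>i\<in>{1..<k}. bracket_span br (V 1) (V i) = V (i + 1)) \<and>
     bracket_span br (V 1) (V k) = {0}"

definition dilation :: "('n \<Rightarrow> nat) \<Rightarrow> real \<Rightarrow> real^'n \<Rightarrow> real^'n" where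
  "dilation \<alpha> r x = (\<chi> i. r ^ \<alpha> i * x $ i)"

text \<open>The layer \<open>V\<^sub>j\<close>, spanned by the coordinate directions scaled by \<open>r\<^sup>j\<close>.\<close>

definition layer :: "('n::finite \<Rightarrow> nat) \<Rightarrow> nat \<Rightarrow> (real^'n) set" where
  "layer \<alpha> j = span {axis i 1 | i. \<alpha> i = j}"

definition homogeneous_dimension :: "('n::finite \<Rightarrow> nat) \<Rightarrow> nat \<Rightarrow> nat" where
  "homogeneous_dimension \<alpha> k = (\<Sum>j=1..k. j * dim (layer \<alpha> j))"

text \<open>The underlying manifold is all of \<open>\<real>\<^sup>n\<close>, so connectedness and simple connectedness are
  automatic, and nilpotency can be expressed in the Lie algebra.  The coordinates carry no
  order; the horizontal ones are those of weight \<open>1\<close>, rather than the first \<open>m\<close>.\<close>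

locale carnot_group = Groups.group gmul 0 ginv
  for gmul :: "real^'n::finite \<Rightarrow> real^'n \<Rightarrow> real^'n" and ginv :: "real^'n \<Rightarrow> real^'n" +
  fixes \<alpha> :: "'n \<Rightarrow> nat" and k :: nat
  assumes smooth_mult: "smooth_on UNIV (\<lambda>(x, y). gmul x y)"
    and smooth_ginv: "smooth_on UNIV ginv"
    and nilpotent: "nilpotent_bracket (lie_bracket gmul)"
    and weight_pos: "\<And>i. 1 \<le> \<alpha> i"
    and stratified: "stratification (lie_bracket gmul) (layer \<alpha>) k"
    and dilation_mult:
      "\<And>r x y. 0 < r \<Longrightarrow> dilation \<alpha> r (gmul x y) = gmul (dilation \<alpha> r x) (dilation \<alpha> r y)"

definition hfield :: "(real^'n \<Rightarrow> real^'n \<Rightarrow> real^'n) \<Rightarrow> 'n::finite \<Rightarrow> real^'n \<Rightarrow> real^'n" where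
  "hfield gmul i = left_field gmul (axis i 1)"

text \<open>The number \<open>m\<close> of horizontal coordinates depends on \<open>\<alpha>\<close>, so \<open>\<real>\<^sup>m\<close> is realised as the
  subspace of \<open>\<real>\<^sup>n\<close> of vectors whose non-horizontal components vanish; the norm and inner
  product of \<open>\<real>\<^sup>n\<close> restrict to the Euclidean ones of \<open>\<real>\<^sup>m\<close>.\<close>

definition hgrad ::
  "(real^'n \<Rightarrow> real^'n \<Rightarrow> real^'n) \<Rightarrow> ('n::finite \<Rightarrow> nat) \<Rightarrow> (real^'n \<Rightarrow> real) \<Rightarrow> real^'n \<Rightarrow> real^'n"
  where "hgrad gmul \<alpha> f x = (\<chi> i. if \<alpha> i = 1 then vf_apply (hfield gmul i) f x else 0)"

definition sub_laplacian ::
  "(real^'n \<Rightarrow> real^'n \<Rightarrow> real^'n) \<Rightarrow> ('n::finite \<Rightarrow> nat) \<Rightarrow> (real^'n \<Rightarrow> real) \<Rightarrow> real^'n \<Rightarrow> real"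
  where "sub_laplacian gmul \<alpha> f x =
    (\<Sum>i\<in>{i. \<alpha> i = 1}. vf_apply (hfield gmul i) (vf_apply (hfield gmul i) f) x)"

definition inf_sub_laplacian ::
  "(real^'n \<Rightarrow> real^'n \<Rightarrow> real^'n) \<Rightarrow> ('n::finite \<Rightarrow> nat) \<Rightarrow> (real^'n \<Rightarrow> real) \<Rightarrow> real^'n \<Rightarrow> real"
  where "inf_sub_laplacian gmul \<alpha> f x =
    1/2 * (hgrad gmul \<alpha> (\<lambda>y. (norm (hgrad gmul \<alpha> f y))\<^sup>2) x \<bullet> hgrad gmul \<alpha> f x)"

text \<open>\<open>-\<Delta>u = \<delta>\<close> in the sense of distributions.  Left invariant fields are skew-adjoint for
  Lebesgue (Haar) measure, so the sub-Laplacian is its own formal adjoint.\<close>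

definition fundamental_solution ::
  "(real^'n \<Rightarrow> real^'n \<Rightarrow> real^'n) \<Rightarrow> ('n::finite \<Rightarrow> nat) \<Rightarrow> (real^'n \<Rightarrow> real) \<Rightarrow> bool" where
  "fundamental_solution gmul \<alpha> u \<longleftrightarrow>
     (\<forall>K. compact K \<longrightarrow> set_integrable lborel K u) \<and>
     (\<forall>\<phi>. test_function UNIV \<phi> \<longrightarrow>
        - (LINT x|lborel. u x * sub_laplacian gmul \<alpha> \<phi> x) = \<phi> 0)"

definition homogeneous_norm ::
  "(real^'n \<Rightarrow> real^'n) \<Rightarrow> ('n::finite \<Rightarrow> nat) \<Rightarrow> (real^'n \<Rightarrow> real) \<Rightarrow> bool" where
  "homogeneous_norm ginv \<alpha> N \<longleftrightarrow>
     (\<forall>x. 0 \<le> N x) \<and> continuous_on UNIV N \<and> smooth_on (- {0}) N \<and>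
     (\<forall>r>0. \<forall>x. N (dilation \<alpha> r x) = r * N x) \<and>
     (\<forall>x. N (ginv x) = N x) \<and> (\<forall>x. N x = 0 \<longleftrightarrow> x = 0)"

definition norm_of :: "nat \<Rightarrow> (real^'n \<Rightarrow> real) \<Rightarrow> real^'n \<Rightarrow> real" where
  "norm_of Q u x = (if x = 0 then 0 else u x powr (1 / (2 - real Q)))"

text \<open>The properties in Folland's theorem.  Positivity off the origin makes the real power
  in \<^const>\<open>norm_of\<close> meaningful; the value of \<open>u\<close> at \<open>0\<close> is irrelevant.\<close>

definition folland_solution ::
  "(real^'n \<Rightarrow> real^'n \<Rightarrow> real^'n) \<Rightarrow> (real^'n \<Rightarrow> real^'n) \<Rightarrow> ('n::finite \<Rightarrow> nat) \<Rightarrow> nat \<Rightarrow>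
    (real^'n \<Rightarrow> real) \<Rightarrow> bool" where
  "folland_solution gmul ginv \<alpha> Q u \<longleftrightarrow>
     fundamental_solution gmul \<alpha> u \<and> (\<forall>x. x \<noteq> 0 \<longrightarrow> 0 < u x) \<and>
     homogeneous_norm ginv \<alpha> (norm_of Q u)"

definition polarizable ::
  "(real^'n \<Rightarrow> real^'n \<Rightarrow> real^'n) \<Rightarrow> ('n::finite \<Rightarrow> nat) \<Rightarrow> (real^'n \<Rightarrow> real) \<Rightarrow> bool" where
  "polarizable gmul \<alpha> N \<longleftrightarrow> (\<forall>x. x \<noteq> 0 \<longrightarrow> inf_sub_laplacian gmul \<alpha> N x = 0)"

end

theory Submission
  imports Defs
begin

text \<open>
  By homogeneity under dilations the coefficient of \<open>\<partial>\<^sub>j\<close> in a horizontal field \<open>X\<^sub>i\<close> does not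
  depend on \<open>x\<^sub>j\<close>, so \<open>X\<^sub>i\<close> is divergence free and \<open>\<integral> X\<^sub>i f = 0\<close> for compactly supported \<open>f\<close>.
  Hence \<open>N\<^bsup>2-Q\<^esup>\<close> is harmonic off the origin, i.e. \<open>\<Delta>N = (Q-1)|\<nabla>N|\<^sup>2/N\<close>, and with the
  \<open>\<infinity>\<close>-sub-Laplace equation
  \<open>div (|\<nabla>N|\<^bsup>p-2\<^esup> N\<^bsup>1-p\<^esup> \<nabla>N) = (Q-p) |\<nabla>N|\<^bsup>p\<^esup> N\<^bsup>-p\<^esup>\<close>
  in the weak sense (after replacing \<open>|\<nabla>N|\<^sup>2\<close> by \<open>|\<nabla>N|\<^sup>2 + \<epsilon>\<close>, since \<open>\<nabla>N\<close> may vanish).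
  Testing with \<open>|\<phi>|\<^bsup>p\<^esup>\<close> and applying Young's inequality with the constant \<open>c = (Q-p)/p\<close> gives
  the Hardy inequality.

  Testing instead with \<open>N\<^bsup>p-Q\<^esup> h(ln N)\<close> shows that \<open>\<Lambda> h = \<integral> |\<nabla>N|\<^bsup>p\<^esup> N\<^bsup>-Q\<^esup> h(ln N)\<close> kills
  derivatives, so \<open>\<Lambda>\<close> is translation invariant. For \<open>\<phi> = N\<^bsup>-c\<^esup> \<psi>(ln N)\<close> with \<open>\<psi>\<close> a long plateau
  the two sides of the inequality are \<open>\<Lambda>(|\<psi>' - c\<psi>|\<^bsup>p\<^esup>)\<close> and \<open>\<Lambda>(\<psi>\<^bsup>p\<^esup>)\<close>; the latter grows linearly
  with the length of the plateau, whereas the former exceeds \<open>c\<^bsup>p\<^esup> \<Lambda>(\<psi>\<^bsup>p\<^esup>)\<close> by a bounded amount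
  only. Here \<open>\<Lambda> \<noteq> 0\<close> because along the one-parameter group of \<open>X\<^sub>i\<close>, on which \<open>X\<^sub>i\<close> is tangent to
  dilation orbits, \<open>N\<close> is not constant.
\<close>

section \<open>Calculus of \<open>C\<^sup>k\<close> functions\<close>

text \<open>Openness enters because derivatives are taken in the whole space: agreement on
  \<open>S\<close> passes to them only where \<open>S\<close> is a neighbourhood of the
  point.\<close>

lemma Ck_on_cong:
  assumes "open S" "\<And>x. x \<in> S \<Longrightarrow> f x = g x"
  shows "Ck_on k S f \<longleftrightarrow> Ck_on k S g"
  using assms(2)
proof (induction k arbitrary: f g)
  case 0
  then show ?case by (simp cong: continuous_on_cong)
next
  case (Suc k)
  have d: "g differentiable (at x)" "frechet_derivative f (at x) = frechet_derivative g (at x)"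
    if "x \<in> S" "f differentiable (at x)" "\<And>x. x \<in> S \<Longrightarrow> f x = g x"
    for x and f g :: "'a \<Rightarrow> 'b"
  proof -
    show "g differentiable (at x)"
      using that \<open>open S\<close> unfolding differentiable_def
      by (blast intro: has_derivative_transform_within_open)
    show "frechet_derivative f (at x) = frechet_derivative g (at x)"
      by (rule frechet_derivative_transform_within_open[OF that(2) \<open>open S\<close> that(1,3)])
  qed
  have "Ck_on (Suc k) S g" if "Ck_on (Suc k) S f" "\<And>x. x \<in> S \<Longrightarrow> f x = g x"
    for f g :: "'a \<Rightarrow> 'b"
  proof -
    have f: "f differentiable (at x)" if "x \<in> S" for x
      using \<open>Ck_on (Suc k) S f\<close> that by simp
    have "Ck_on k S (\<lambda>x. frechet_derivative g (at x) v)" for v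
      using Suc.IH[of "\<lambda>x. frechet_derivative f (at x) v" "\<lambda>x. frechet_derivative g (at x) v"]
        d(2)[OF _ f that(2)] that(1) by simp
    then show ?thesis using d(1)[OF _ f that(2)] by simp
  qed
  from this[of f g] this[of g f] Suc.prems show ?case by metis
qed

lemma Ck_on_subset: "Ck_on k S f \<Longrightarrow> T \<subseteq> S \<Longrightarrow> Ck_on k T f"
  by (induction k arbitrary: f) (auto intro: continuous_on_subset)

lemma Ck_on_Un:
  "open S \<Longrightarrow> open T \<Longrightarrow> Ck_on k S f \<Longrightarrow> Ck_on k T f \<Longrightarrow> Ck_on k (S \<union> T) f"
  by (induction k arbitrary: f) (auto intro: continuous_on_open_Un)

lemma Ck_on_differentiable: "Ck_on (Suc k) S f \<Longrightarrow> x \<in> S \<Longrightarrow> f differentiable (at x)"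
  by simp

lemma Ck_on_SucD: "Ck_on (Suc k) S f \<Longrightarrow> Ck_on k S f"
proof (induction k arbitrary: f)
  case 0
  then show ?case
    by (auto intro!: continuous_at_imp_continuous_on differentiable_imp_continuous_within)
next
  case (Suc k)
  then show ?case by (metis Ck_on.simps(2))
qed

lemma Ck_on_imp_continuous_on: "Ck_on k S f \<Longrightarrow> continuous_on S f"
proof (induction k)
  case (Suc k)
  then show ?case using Ck_on_SucD by blast
qed simp

text \<open>The definition speaks of \<open>frechet_derivative\<close>, a chosen derivative. Here
  any explicit derivative will do, which is how most rules below climb one order of
  differentiability.\<close>

lemma Ck_on_SucI:
  assumes "open S" and "\<And>x. x \<in> S \<Longrightarrow> (f has_derivative f' x) (at x)"
    and "\<And>v. Ck_on k S (\<lambda>x. f' x v)"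
  shows "Ck_on (Suc k) S f"
proof -
  have "Ck_on k S (\<lambda>x. frechet_derivative f (at x) v)" for v
    using Ck_on_cong[OF \<open>open S\<close>, of "\<lambda>x. frechet_derivative f (at x) v" "\<lambda>x. f' x v" k]
      assms(3)[of v] frechet_derivative_at[OF assms(2)] by simp
  then show ?thesis using assms(2) by (auto simp: differentiable_def)
qed

section \<open>Closure properties of the class C^k\<close>

lemma Ck_on_const [simp]: "Ck_on k S (\<lambda>x. c)"
proof (induction k arbitrary: c)
  case (Suc k)
  have "frechet_derivative (\<lambda>x. c) (at x) = (\<lambda>_. 0)" for x :: 'a
    by (rule frechet_derivative_const)
  with Suc show ?case by simp
qed simp

lemma Ck_on_bounded_linear:
  assumes "bounded_linear f"
  shows "Ck_on k S f"
proof (cases k)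
  case 0
  then show ?thesis using assms by (simp add: linear_continuous_on)
next
  case (Suc l)
  have "frechet_derivative f (at x) = f" for x
    by (rule frechet_derivative_at[symmetric, OF bounded_linear_imp_has_derivative[OF assms]])
  moreover have "f differentiable (at x)" for x
    using assms bounded_linear_imp_differentiable by blast
  ultimately show ?thesis using Suc by simp
qed

lemma Ck_on_bounded_linear_left:
  assumes "bounded_linear h" "open S" "Ck_on k S f"
  shows "Ck_on k S (\<lambda>x. h (f x))"
  using assms(3)
proof (induction k arbitrary: f)
  case 0
  then show ?case using assms(1) by (simp add: bounded_linear.continuous_on)
next
  case (Suc k)
  show ?case
  proof (rule Ck_on_SucI[OF \<open>open S\<close>])
    show "((\<lambda>x. h (f x)) has_derivative (\<lambda>v. h (frechet_derivative f (at x) v))) (at x)" if "x \<in> S" for x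
      by (rule bounded_linear.has_derivative[OF assms(1)])
         (use Suc.prems that in \<open>simp add: frechet_derivative_works\<close>)
    show "Ck_on k S (\<lambda>x. h (frechet_derivative f (at x) v))" for v
      using Suc.prems by (intro Suc.IH) simp
  qed
qed

lemma Ck_on_compose_bounded_linear:
  assumes "bounded_linear h" "open S" "\<And>x. x \<in> S \<Longrightarrow> h x \<in> T" "Ck_on k T f"
  shows "Ck_on k S (\<lambda>x. f (h x))"
  using assms(4)
proof (induction k arbitrary: f)
  case 0
  then show ?case using assms(1,3)
    by (auto intro!: continuous_on_compose2[of T f] simp: linear_continuous_on)
next
  case (Suc k)
  show ?case
  proof (rule Ck_on_SucI[OF \<open>open S\<close>])
    show "((\<lambda>x. f (h x)) has_derivative (\<lambda>v. frechet_derivative f (at (h x)) (h v))) (at x)"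
      if "x \<in> S" for x
      using Suc.prems that assms(3)
      by (intro has_derivative_compose[OF bounded_linear_imp_has_derivative[OF assms(1)]])
         (simp add: frechet_derivative_works)
    show "Ck_on k S (\<lambda>x. frechet_derivative f (at (h x)) (h v))" for v
      using Suc.IH[of "\<lambda>y. frechet_derivative f (at y) (h v)"] Suc.prems by simp
  qed
qed

lemma Ck_on_add:
  assumes "open S" "Ck_on k S f" "Ck_on k S g"
  shows "Ck_on k S (\<lambda>x. f x + g x)"
  using assms(2,3)
proof (induction k arbitrary: f g)
  case 0
  then show ?case by (simp add: continuous_on_add)
next
  case (Suc k)
  show ?case
  proof (rule Ck_on_SucI[OF \<open>open S\<close>])
    show "((\<lambda>x. f x + g x) has_derivative
        (\<lambda>v. frechet_derivative f (at x) v + frechet_derivative g (at x) v)) (at x)" if "x \<in> S" for x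
      using Suc.prems that by (intro has_derivative_add) (auto simp: frechet_derivative_works)
  qed (use Suc in simp)
qed

lemma Ck_on_sum:
  assumes "open S" "\<And>i. i \<in> I \<Longrightarrow> Ck_on k S (f i)"
  shows "Ck_on k S (\<lambda>x. \<Sum>i\<in>I. f i x)"
  using assms(2)
proof (induction I rule: infinite_finite_induct)
  case (insert j I)
  have "Ck_on k S (\<lambda>x. f j x + (\<Sum>i\<in>I. f i x))"
    using insert by (intro Ck_on_add[OF \<open>open S\<close>]) simp_all
  then show ?case using insert.hyps by simp
qed simp_all

lemma Ck_on_mult:
  fixes f g :: "'a::real_normed_vector \<Rightarrow> real"
  assumes "open S" "Ck_on k S f" "Ck_on k S g"
  shows "Ck_on k S (\<lambda>x. f x * g x)"
  using assms(2,3)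
proof (induction k arbitrary: f g)
  case 0
  then show ?case by (simp add: continuous_on_mult)
next
  case (Suc k)
  show ?case
  proof (rule Ck_on_SucI[OF \<open>open S\<close>])
    show "((\<lambda>x. f x * g x) has_derivative
        (\<lambda>v. f x * frechet_derivative g (at x) v + frechet_derivative f (at x) v * g x)) (at x)"
      if "x \<in> S" for x
      using Suc.prems that by (intro has_derivative_mult) (auto simp: frechet_derivative_works)
    show "Ck_on k S (\<lambda>x. f x * frechet_derivative g (at x) v + frechet_derivative f (at x) v * g x)" for v
    proof (rule Ck_on_add[OF \<open>open S\<close>])
      show "Ck_on k S (\<lambda>x. f x * frechet_derivative g (at x) v)"
        using Suc.prems by (intro Suc.IH) (simp_all add: Ck_on_SucD del: Ck_on.simps, simp)
      show "Ck_on k S (\<lambda>x. frechet_derivative f (at x) v * g x)"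
        using Suc.prems by (intro Suc.IH) (simp_all add: Ck_on_SucD del: Ck_on.simps, simp)
    qed
  qed
qed

lemma Ck_on_diff:
  fixes f g :: "'a::real_normed_vector \<Rightarrow> real"
  assumes "open S" "Ck_on k S f" "Ck_on k S g"
  shows "Ck_on k S (\<lambda>x. f x - g x)"
  using Ck_on_add[OF assms(1,2) Ck_on_mult[OF assms(1) Ck_on_const[of k S "-1"] assms(3)]] by simp

lemma Ck_on_real_SucI:
  fixes g :: "real \<Rightarrow> real"
  assumes "open T" "\<And>t. t \<in> T \<Longrightarrow> (g has_real_derivative g' t) (at t)" "Ck_on k T g'"
  shows "Ck_on (Suc k) T g"
proof (rule Ck_on_SucI[OF \<open>open T\<close>, where f' = "\<lambda>t v. g' t * v"])
  show "(g has_derivative (\<lambda>v. g' t * v)) (at t)" if "t \<in> T" for t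
    using assms(2)[OF that] by (simp add: has_field_derivative_def)
  show "Ck_on k T (\<lambda>t. g' t * v)" for v
    by (rule Ck_on_mult[OF \<open>open T\<close> assms(3) Ck_on_const])
qed

text \<open>The outer function has one real variable, so its derivative is multiplication by
  \<open>?g'\<close>. The chain rule then yields a product, and the induction closes by
  \<open>Ck_on_mult\<close>.\<close>

lemma Ck_on_compose:
  fixes g :: "real \<Rightarrow> real"
  assumes "open S" "\<And>x. x \<in> S \<Longrightarrow> h x \<in> T" "Ck_on k S h" "Ck_on k T g"
  shows "Ck_on k S (\<lambda>x. g (h x))"
  using assms(3,4)
proof (induction k arbitrary: g)
  case 0
  then show ?case using assms(2) by (auto intro!: continuous_on_compose2[of T g])
next
  case (Suc k)
  let ?g' = "\<lambda>t. frechet_derivative g (at t) 1"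
  show ?case
  proof (rule Ck_on_SucI[OF \<open>open S\<close>])
    show "((\<lambda>x. g (h x)) has_derivative (\<lambda>v. frechet_derivative h (at x) v * ?g' (h x))) (at x)"
      if "x \<in> S" for x
    proof -
      have "linear (frechet_derivative g (at (h x)))"
        using Suc.prems that assms(2) by (auto intro: linear_frechet_derivative)
      then have eq: "t * ?g' (h x) = frechet_derivative g (at (h x)) t" for t
        using linear_cmul[of "frechet_derivative g (at (h x))" t 1]
        by (simp only: real_scaleR_def mult_1_right)
      have "(h has_derivative frechet_derivative h (at x)) (at x)"
        using Suc.prems(1) that by (simp add: frechet_derivative_works)
      moreover have "(g has_derivative frechet_derivative g (at (h x))) (at (h x))"
        using Suc.prems(2) that assms(2) by (simp add: frechet_derivative_works)
      ultimately show ?thesis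
        unfolding eq by (rule has_derivative_compose)
    qed
    show "Ck_on k S (\<lambda>x. frechet_derivative h (at x) v * ?g' (h x))" for v
      using Suc.prems(2) Ck_on_SucD[OF Suc.prems(1)]
      by (intro Ck_on_mult[OF \<open>open S\<close>] Suc.IH[of ?g']) (use Suc.prems(1) in auto)
  qed
qed

lemma Ck_on_exp: "Ck_on k UNIV (\<lambda>t::real. exp (a * t))"
proof (induction k)
  case 0
  then show ?case by (auto intro!: continuous_intros)
next
  case (Suc k)
  show ?case
    by (rule Ck_on_real_SucI[where g' = "\<lambda>t. a * exp (a * t)"])
       (auto intro!: derivative_eq_intros Ck_on_mult Suc)
qed

text \<open>Each derivative lowers the exponent by one, hence the induction over all exponents at
  once.\<close>

lemma Ck_on_powr: "Ck_on k {0<..} (\<lambda>t::real. t powr a)"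
proof (induction k arbitrary: a)
  case 0
  then show ?case by (auto intro!: continuous_intros)
next
  case (Suc k)
  show ?case
    by (rule Ck_on_real_SucI[where g' = "\<lambda>t. a * t powr (a - 1)"])
       (auto intro!: has_real_derivative_powr Ck_on_mult Suc)
qed

lemma Ck_on_ln: "Ck_on k {0<..} (ln :: real \<Rightarrow> real)"
proof (cases k)
  case 0
  then show ?thesis by (auto intro!: continuous_intros)
next
  case (Suc l)
  show ?thesis unfolding Suc
  proof (rule Ck_on_real_SucI[OF _ _ Ck_on_powr[of l "-1"]])
    show "(ln has_real_derivative t powr - 1) (at t)" if "t \<in> {0<..}" for t
      using DERIV_ln_divide[of t] that by (simp add: powr_minus_divide)
  qed simp
qed

text \<open>The classical flat function is \<open>flat 1\<close>; the polynomial factor makes the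
  family closed under differentiation.\<close>

definition flat :: "real poly \<Rightarrow> real \<Rightarrow> real" where
  "flat P t = (if t \<le> 0 then 0 else poly P (1/t) * exp (- (1/t)))"

text \<open>With s = 1/t, the t-derivative of P(s) exp(-s) is (P - P')(s) s^2 exp(-s). At t = 0 the
  exponential beats every polynomial in 1/t.\<close>

lemma flat_derivative:
  "(flat P has_real_derivative flat ((P - pderiv P) * monom 1 2) t) (at t)"
proof -
  let ?Q = "(P - pderiv P) * monom 1 2"
  have lim0: "((\<lambda>t. poly R (1/t) * exp (- (1/t))) \<longlongrightarrow> 0) (at_right 0)" for R :: "real poly"
  proof -
    have "((\<lambda>x. poly R x * exp (- x)) \<longlongrightarrow> 0) at_top"
    proof (induction R)
      case 0
      then show ?case by simp
    next
      case (pCons a R)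
      have "((\<lambda>x. \<Sum>i\<le>degree (pCons a R). coeff (pCons a R) i * (x ^ i / exp x)) \<longlongrightarrow>
          (\<Sum>i\<le>degree (pCons a R). coeff (pCons a R) i * 0)) at_top"
        by (intro tendsto_intros tendsto_power_div_exp_0)
      moreover have "(\<lambda>x. \<Sum>i\<le>degree (pCons a R). coeff (pCons a R) i * (x ^ i / exp x))
          = (\<lambda>x. poly (pCons a R) x * exp (- x))"
        unfolding poly_altdef by (auto simp: sum_distrib_right exp_minus divide_inverse mult.assoc)
      ultimately show ?case by simp
    qed
    then show ?thesis
      unfolding filterlim_at_right_to_top by (simp add: inverse_eq_divide)
  qed
  consider "t < 0" | "t = 0" | "t > 0" by linarith
  then show ?thesis
  proof cases
    case 1
    have "((\<lambda>_. 0) has_real_derivative 0) (at t)" by simp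
    then have "(flat P has_real_derivative 0) (at t)"
      by (rule has_field_derivative_transform_within_open[where S = "{..<0}"])
         (use 1 in \<open>auto simp: flat_def\<close>)
    then show ?thesis using 1 by (simp add: flat_def)
  next
    case 3
    have "((\<lambda>t. poly P (1/t) * exp (- (1/t))) has_real_derivative flat ?Q t) (at t)"
    proof -
      have a: "((\<lambda>t. 1/t) has_real_derivative - (1/t)\<^sup>2) (at t)"
        using 3 by (auto intro!: derivative_eq_intros simp: power2_eq_square)
      show ?thesis
        using DERIV_mult[OF DERIV_chain2[OF poly_DERIV a] DERIV_chain2[OF DERIV_exp DERIV_minus[OF a]]] 3
        by (simp add: flat_def poly_monom algebra_simps)
    qed
    then show ?thesis
      by (rule has_field_derivative_transform_within_open[where S = "{0<..}"])
         (use 3 in \<open>auto simp: flat_def\<close>)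
  next
    case 2
    have "((\<lambda>h. (flat P h - flat P 0) / h) \<longlongrightarrow> 0) (at 0)"
    proof (rule filterlim_split_at)
      show "((\<lambda>h. (flat P h - flat P 0) / h) \<longlongrightarrow> 0) (at_left 0)"
        by (rule tendsto_eventually)
           (auto simp: flat_def eventually_at_filter)
      show "((\<lambda>h. (flat P h - flat P 0) / h) \<longlongrightarrow> 0) (at_right 0)"
        \<comment> \<open>The division by h is absorbed into the polynomial as one more factor
          1/h.\<close>
        using lim0[of "P * monom 1 1"]
        by (rule Lim_transform_eventually)
           (auto simp: flat_def eventually_at_filter poly_monom field_simps)
    qed
    then show ?thesis using 2 by (simp add: has_field_derivative_iff flat_def)
  qed
qed

lemma Ck_on_flat: "Ck_on k UNIV (flat P)"
proof (induction k arbitrary: P)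
  case 0
  have "isCont (flat P) t" for t
    by (rule DERIV_isCont[OF flat_derivative])
  then show ?case by (simp add: continuous_at_imp_continuous_on)
next
  case (Suc k)
  show ?case by (rule Ck_on_real_SucI[OF open_UNIV flat_derivative Suc])
qed

section \<open>Integration by parts along horizontal fields\<close>

lemma integrable_compact_support:
  fixes f :: "'a::euclidean_space \<Rightarrow> real"
  assumes "compact K" "continuous_on K f" "\<And>x. x \<notin> K \<Longrightarrow> f x = 0"
  shows "integrable lborel f"
proof -
  have "(\<lambda>x. indicator K x *\<^sub>R f x) = f"
    using assms(3) by (auto simp: indicator_def fun_eq_iff)
  then show ?thesis using borel_integrable_compact[OF assms(1,2)] by simp
qed

text \<open>The open sets \<open>S\<close> and \<open>- K\<close> cover the space, and the function
  is zero on the second.\<close>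

lemma Ck_on_extend_zero:
  assumes "open S" "compact K" "K \<subseteq> S" "Ck_on k S f" "\<And>x. x \<notin> K \<Longrightarrow> f x = 0"
  shows "Ck_on k UNIV f"
proof -
  have "open (- K)" using assms(2) by (simp add: compact_imp_closed open_Compl)
  moreover have "Ck_on k (- K) f"
    using Ck_on_cong[OF \<open>open (- K)\<close>, of f "\<lambda>_. 0" k] assms(5) by simp
  ultimately have "Ck_on k (S \<union> - K) f" using assms(1,4) by (intro Ck_on_Un)
  moreover have "S \<union> - K = UNIV" using assms(3) by auto
  ultimately show ?thesis by simp
qed

lemma frechet_derivative_zero_outside:
  fixes f :: "'a::real_normed_vector \<Rightarrow> real"
  assumes "closed K" "\<And>x. x \<notin> K \<Longrightarrow> f x = 0" "x \<notin> K"
  shows "frechet_derivative f (at x) v = 0"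
proof -
  have "((\<lambda>_. 0) has_derivative (\<lambda>_. 0)) (at x)" by simp
  then have "(f has_derivative (\<lambda>_. 0)) (at x)"
    by (rule has_derivative_transform_within_open[where s = "- K"]) (use assms in auto)
  from frechet_derivative_at[OF this] show ?thesis by metis
qed

section \<open>Vanishing integrals of directional derivatives\<close>

lemma lborel_integral_translate:
  fixes f :: "'a::euclidean_space \<Rightarrow> real"
  assumes "f \<in> borel_measurable borel"
  shows "(LINT x|lborel. f (x + c)) = (LINT x|lborel. f x)"
proof -
  have "(LINT x|distr lborel borel ((+) c). f x) = (LINT x|lborel. f (c + x))"
    by (rule integral_distr) (use assms in auto)
  then show ?thesis by (simp add: lborel_distr_plus add.commute)
qed

text \<open>Difference quotients have integral 0 because Lebesgue measure is translation invariant;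
  dominated convergence carries this over to the derivative.\<close>

lemma integral_directional_derivative:
  fixes g :: "'a::euclidean_space \<Rightarrow> real"
  assumes C1: "Ck_on (Suc 0) UNIV g" and K: "compact K" "\<And>x. x \<notin> K \<Longrightarrow> g x = 0"
  shows "(LINT x|lborel. frechet_derivative g (at x) v) = 0"
proof -
  let ?d = "\<lambda>x. frechet_derivative g (at x) v"
  have der: "(g has_derivative frechet_derivative g (at x)) (at x)" for x
    using C1 by (simp add: frechet_derivative_works)
  have cont: "continuous_on UNIV g" "continuous_on UNIV ?d"
    using C1 Ck_on_imp_continuous_on[OF C1] by auto
  have line: "((\<lambda>s. g (x + s *\<^sub>R v)) has_real_derivative ?d (x + s *\<^sub>R v)) (at s)" for x s
  proof -
    have "((\<lambda>s. g (x + s *\<^sub>R v)) has_derivative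
        (\<lambda>h. frechet_derivative g (at (x + s *\<^sub>R v)) (h *\<^sub>R v))) (at s)"
      by (rule has_derivative_compose[OF _ der]) (auto intro!: derivative_eq_intros)
    moreover have "frechet_derivative g (at (x + s *\<^sub>R v)) (h *\<^sub>R v) = ?d (x + s *\<^sub>R v) * h" for h
      using linear_cmul[OF linear_frechet_derivative[OF differentiableI[OF der]], of "x + s *\<^sub>R v" h v]
      by simp
    ultimately show ?thesis by (simp add: has_field_derivative_def)
  qed
  obtain B where B: "\<And>x. \<bar>?d x\<bar> \<le> B" "0 \<le> B"
  proof -
    have "bounded (?d ` K)"
      by (intro compact_imp_bounded compact_continuous_image K(1) continuous_on_subset[OF cont(2)]) auto
    then obtain b where b: "\<And>x. x \<in> K \<Longrightarrow> \<bar>?d x\<bar> \<le> b"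
      by (auto simp: bounded_iff)
    have "\<bar>?d x\<bar> \<le> max b 0" for x
    proof (cases "x \<in> K")
      case True
      then show ?thesis using b by fastforce
    next
      case False
      then show ?thesis
        using frechet_derivative_zero_outside[where f = g, OF compact_imp_closed[OF K(1)] K(2), of x v] by simp
    qed
    then show ?thesis by (intro that[of "max b 0"]) auto
  qed
  \<comment> \<open>A compact set outside which every difference quotient with step at most 1
    vanishes; it supports the dominating function.\<close>
  define K' where "K' = (\<lambda>(x, s). x - s *\<^sub>R v) ` (K \<times> {0..1})"
  have "compact K'"
    unfolding K'_def case_prod_unfold
    by (intro compact_continuous_image compact_Times K(1) compact_Icc continuous_intros)
  define t :: "nat \<Rightarrow> real" where "t n = inverse (real (Suc n))" for n
  have t: "0 < t n" "t n \<le> 1" for n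
    by (auto simp: t_def divide_simps)
  have t0: "t \<longlonglongrightarrow> 0"
    unfolding t_def by (rule LIMSEQ_inverse_real_of_nat)
  define D where "D n x = (g (x + t n *\<^sub>R v) - g x) / t n" for n x
  have gi: "integrable lborel g"
    by (rule integrable_compact_support[OF K(1) continuous_on_subset[OF cont(1)] K(2)]) auto
  have "integrable lborel (\<lambda>x. g (x + c))" for c
  proof (rule integrable_compact_support[of "(\<lambda>x. x - c) ` K"])
    show "compact ((\<lambda>x. x - c) ` K)" using K(1) by (intro compact_continuous_image continuous_intros)
    show "continuous_on ((\<lambda>x. x - c) ` K) (\<lambda>x. g (x + c))"
      by (rule continuous_on_compose2[OF cont(1)]) (auto intro!: continuous_intros)
    show "g (x + c) = 0" if "x \<notin> (\<lambda>x. x - c) ` K" for x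
      using that by (intro K(2)) (metis add_diff_cancel_right' image_eqI)
  qed
  then have int0: "(LINT x|lborel. D n x) = 0" for n
    using gi lborel_integral_translate[OF borel_measurable_continuous_onI[OF cont(1)], of "t n *\<^sub>R v"]
    unfolding D_def by simp
  have "(\<lambda>n. LINT x|lborel. D n x) \<longlonglongrightarrow> (LINT x|lborel. ?d x)"
  proof (rule integral_dominated_convergence[where w = "\<lambda>x. indicator K' x * B"])
    show "?d \<in> borel_measurable lborel"
      using borel_measurable_continuous_onI[OF cont(2)] by simp
    show "D n \<in> borel_measurable lborel" for n
    proof -
      have "continuous_on UNIV (\<lambda>x. g (x + t n *\<^sub>R v))"
        by (rule continuous_on_compose2[OF cont(1)]) (auto intro!: continuous_intros)
      then have "continuous_on UNIV (D n)"
        unfolding D_def using cont(1) t[of n] by (auto intro!: continuous_intros)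
      then show ?thesis using borel_measurable_continuous_onI by auto
    qed
    show "integrable lborel (\<lambda>x. indicator K' x * B)"
      using borel_integrable_compact[OF \<open>compact K'\<close> continuous_on_const[of _ B]] by simp
    show "AE x in lborel. (\<lambda>n. D n x) \<longlonglongrightarrow> ?d x"
    proof (rule AE_I2)
      fix x
      have "((\<lambda>h. (g (x + h *\<^sub>R v) - g x) / h) \<longlongrightarrow> ?d x) (at 0)"
        using line[of x 0] by (simp add: has_field_derivative_iff)
      moreover have "filterlim t (at 0) sequentially"
        using t0 t(1) by (auto simp: filterlim_at less_imp_neq[symmetric] intro!: always_eventually)
      ultimately show "(\<lambda>n. D n x) \<longlonglongrightarrow> ?d x"
        unfolding D_def by (rule filterlim_compose)
    qed
    show "AE x in lborel. norm (D n x) \<le> indicator K' x * B" for n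
    proof (rule AE_I2)
      fix x
      show "norm (D n x) \<le> indicator K' x * B"
      proof (cases "x \<in> K'")
        case True
        \<comment> \<open>The mean value theorem turns the quotient into a value of the derivative,
          so the bound \<open>B\<close> applies uniformly in n.\<close>
        obtain z where z: "g (x + t n *\<^sub>R v) - g (x + 0 *\<^sub>R v) = (t n - 0) * ?d (x + z *\<^sub>R v)"
          using MVT2[OF t(1)[of n], of "\<lambda>s. g (x + s *\<^sub>R v)" "\<lambda>s. ?d (x + s *\<^sub>R v)"] line by blast
        then have "D n x = ?d (x + z *\<^sub>R v)"
          using t(1)[of n] by (simp add: D_def)
        then show ?thesis using B True by simp
      next
        case False
        have "x + s *\<^sub>R v \<notin> K" if "s \<in> {0..1}" for s
        proof
          assume "x + s *\<^sub>R v \<in> K"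
          then have "x + s *\<^sub>R v - s *\<^sub>R v \<in> K'" unfolding K'_def using that by force
          with False show False by simp
        qed
        from this[of 0] this[of "t n"] have "D n x = 0"
          using t[of n] K(2) by (simp add: D_def)
        then show ?thesis using False by simp
      qed
    qed
  qed
  with int0 show ?thesis by (simp add: LIMSEQ_const_iff)
qed

section \<open>Calculus of vector fields in coordinates\<close>

lemma frechet_derivative_components:
  fixes f :: "real^'n::finite \<Rightarrow> real"
  assumes "f differentiable (at x)"
  shows "frechet_derivative f (at x) v = (\<Sum>j\<in>UNIV. v $ j * frechet_derivative f (at x) (axis j 1))"
proof -
  interpret linear "frechet_derivative f (at x)"
    using assms by (rule linear_frechet_derivative)
  have "frechet_derivative f (at x) v = frechet_derivative f (at x) (\<Sum>j\<in>UNIV. v $ j *\<^sub>R axis j 1)"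
    using basis_expansion[of v] by (simp add: scalar_mult_eq_scaleR)
  then show ?thesis by (simp add: sum scale)
qed

lemma Ck_on_component:
  fixes f :: "'a::real_normed_vector \<Rightarrow> real^'n"
  shows "open S \<Longrightarrow> Ck_on k S f \<Longrightarrow> Ck_on k S (\<lambda>x. f x $ j)"
  by (rule Ck_on_bounded_linear_left[OF bounded_linear_vec_nth])

lemma Ck_on_vf_apply:
  fixes f :: "real^'n::finite \<Rightarrow> real"
  assumes "open S" "Ck_on (Suc k) S f" "Ck_on k S X"
  shows "Ck_on k S (vf_apply X f)"
proof (rule iffD2[OF Ck_on_cong[OF assms(1)]])
  show "Ck_on k S (\<lambda>x. \<Sum>j\<in>UNIV. X x $ j * frechet_derivative f (at x) (axis j 1))"
    using assms by (intro Ck_on_sum Ck_on_mult Ck_on_component) auto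
  show "vf_apply X f x = (\<Sum>j\<in>UNIV. X x $ j * frechet_derivative f (at x) (axis j 1))"
    if "x \<in> S" for x
    unfolding vf_apply_def using assms(2) that by (intro frechet_derivative_components) simp
qed

lemma vf_apply_mult:
  assumes "f differentiable (at x)" "g differentiable (at x)"
  shows "vf_apply X (\<lambda>x. f x * g x) x = f x * vf_apply X g x + vf_apply X f x * g x"
proof -
  have "((\<lambda>x. f x * g x) has_derivative
      (\<lambda>v. f x * frechet_derivative g (at x) v + frechet_derivative f (at x) v * g x)) (at x)"
    using assms by (intro has_derivative_mult) (auto simp: frechet_derivative_works)
  from frechet_derivative_at[OF this, symmetric] show ?thesis
    unfolding vf_apply_def by simp
qed

lemma vf_apply_diff:
  assumes "f differentiable (at x)" "g differentiable (at x)"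
  shows "vf_apply X (\<lambda>x. f x - g x) x = vf_apply X f x - vf_apply X g x"
proof -
  have "((\<lambda>x. f x - g x) has_derivative
      (\<lambda>v. frechet_derivative f (at x) v - frechet_derivative g (at x) v)) (at x)"
    using assms by (intro has_derivative_diff) (auto simp: frechet_derivative_works)
  from frechet_derivative_at[OF this, symmetric] show ?thesis
    unfolding vf_apply_def by simp
qed

lemma vf_apply_compose:
  assumes "f differentiable (at x)" "(h has_real_derivative h') (at (f x))"
  shows "vf_apply X (\<lambda>x. h (f x)) x = h' * vf_apply X f x"
proof -
  have "((\<lambda>x. h (f x)) has_derivative (\<lambda>v. h' * frechet_derivative f (at x) v)) (at x)"
    using has_derivative_compose[of f _ x UNIV h "(*) h'"] assms
    by (simp add: frechet_derivative_works has_field_derivative_def)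
  from frechet_derivative_at[OF this, symmetric] show ?thesis
    unfolding vf_apply_def by simp
qed

lemma vf_apply_cong:
  assumes "open S" "x \<in> S" "\<And>y. y \<in> S \<Longrightarrow> f y = g y" "f differentiable (at x)"
  shows "vf_apply X f x = vf_apply X g x"
  unfolding vf_apply_def
  using frechet_derivative_transform_within_open[OF assms(4,1,2,3)] by simp

section \<open>Dilations and the coefficients of horizontal fields\<close>

lemma dilation_component [simp]: "dilation \<alpha> r x $ i = r ^ \<alpha> i * x $ i"
  by (simp add: dilation_def)

lemma bounded_linear_dilation: "bounded_linear (dilation \<alpha> r :: real^'n::finite \<Rightarrow> _)"
  by (rule linear_conv_bounded_linear[THEN iffD1], rule linearI)
     (auto simp: vec_eq_iff algebra_simps)

lemma dilation_axis: "dilation \<alpha> r (axis i 1) = r ^ \<alpha> i *\<^sub>R axis i 1"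
  by (auto simp: vec_eq_iff axis_def)

context carnot_group
begin

abbreviation X :: "'n \<Rightarrow> (real^'n \<Rightarrow> real) \<Rightarrow> real^'n \<Rightarrow> real" where
  "X i \<equiv> vf_apply (hfield gmul i)"

lemma gmul_derivative:
  "(gmul x has_derivative (\<lambda>v. frechet_derivative (\<lambda>(x, y). gmul x y) (at (x, y)) (0, v))) (at y)"
proof -
  let ?M = "\<lambda>(x, y). gmul x y"
  have "Ck_on (Suc 0) UNIV ?M" using smooth_mult unfolding smooth_on_def by blast
  then have "(?M has_derivative frechet_derivative ?M (at (x, y))) (at (x, y))"
    by (simp add: frechet_derivative_works)
  from has_derivative_compose[OF has_derivative_Pair[OF has_derivative_const has_derivative_ident], OF this]
  show ?thesis by simp
qed

text \<open>The field is a partial derivative of the smooth group law in its second argument,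
  restricted to the points \<open>(x, 0)\<close>.\<close>

lemma Ck_on_hfield: "Ck_on l UNIV (hfield gmul i)"
proof -
  let ?M = "\<lambda>(x, y). gmul x y"
  have "Ck_on (Suc l) UNIV ?M" using smooth_mult unfolding smooth_on_def by blast
  then have "Ck_on l UNIV (\<lambda>z. frechet_derivative ?M (at z) (0, axis i 1))" by simp
  moreover have "bounded_linear (\<lambda>x::real^'n. (x, 0::real^'n))"
    by (intro bounded_linear_Pair bounded_linear_ident bounded_linear_zero)
  ultimately have "Ck_on l UNIV (\<lambda>x. frechet_derivative ?M (at (x, 0)) (0, axis i 1))"
    by (rule Ck_on_compose_bounded_linear[rotated 3]) auto
  moreover have "frechet_derivative (gmul x) (at 0) (axis i 1)
      = frechet_derivative ?M (at (x, 0)) (0, axis i 1)" for x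
    using frechet_derivative_at[OF gmul_derivative[of x 0]] by metis
  ultimately show ?thesis
    by (simp add: hfield_def left_field_def[abs_def])
qed

lemma left_field_linear: "linear (\<lambda>v. left_field gmul v x)"
  unfolding left_field_def
  using linear_frechet_derivative[OF differentiableI[OF gmul_derivative[of x 0]]] by simp

text \<open>Differentiate in y, at y = 0, the identity saying that dilations are
  automorphisms.\<close>

lemma left_field_dilation:
  assumes "0 < r"
  shows "left_field gmul (dilation \<alpha> r v) (dilation \<alpha> r x) = dilation \<alpha> r (left_field gmul v x)"
proof -
  have d: "(gmul x has_derivative frechet_derivative (gmul x) (at y)) (at y)" for x y
    using differentiableI[OF gmul_derivative[of x y]] by (simp add: frechet_derivative_works)
  have 0: "dilation \<alpha> r 0 = (0::real^'n)" by (simp add: vec_eq_iff)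
  have "((\<lambda>y. dilation \<alpha> r (gmul x y)) has_derivative
      (\<lambda>v. dilation \<alpha> r (frechet_derivative (gmul x) (at 0) v))) (at 0)"
    by (rule bounded_linear.has_derivative[OF bounded_linear_dilation d])
  moreover have "((\<lambda>y. gmul (dilation \<alpha> r x) (dilation \<alpha> r y)) has_derivative
      (\<lambda>v. frechet_derivative (gmul (dilation \<alpha> r x)) (at (dilation \<alpha> r 0)) (dilation \<alpha> r v))) (at 0)"
    by (rule has_derivative_compose[OF bounded_linear_imp_has_derivative[OF bounded_linear_dilation] d])
  ultimately have "(\<lambda>v. dilation \<alpha> r (frechet_derivative (gmul x) (at 0) v))
      = (\<lambda>v. frechet_derivative (gmul (dilation \<alpha> r x)) (at 0) (dilation \<alpha> r v))"
    unfolding 0 dilation_mult[OF assms] by (rule has_derivative_unique)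
  then show ?thesis unfolding left_field_def by metis
qed

text \<open>A horizontal axis vector is an eigenvector of the dilation with eigenvalue r. Thus the
  j-th coefficient is homogeneous of degree \<open>\<alpha> j - 1\<close>; multiplying through by r
  avoids the subtraction.\<close>

lemma hfield_dilation:
  assumes "0 < r" "\<alpha> i = 1"
  shows "r * hfield gmul i (dilation \<alpha> r x) $ j = r ^ \<alpha> j * hfield gmul i x $ j"
proof -
  have "r *\<^sub>R left_field gmul (axis i 1) (dilation \<alpha> r x) = dilation \<alpha> r (left_field gmul (axis i 1) x)"
    using left_field_dilation[OF assms(1), of "axis i 1" x] linear_cmul[OF left_field_linear] assms(2)
    by (simp add: dilation_axis)
  then show ?thesis unfolding hfield_def by (metis dilation_component vector_scaleR_component real_scaleR_def)
qed

lemma hfield_0: "hfield gmul i 0 = axis i 1"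
proof -
  have "gmul 0 = id" by (auto simp: fun_eq_iff)
  then show ?thesis
    by (simp add: hfield_def left_field_def)
qed

text \<open>A coefficient of weight \<open>\<alpha> j - 1\<close> has a partial derivative of negative weight in every
  direction \<open>l\<close> with \<open>\<alpha> l \<ge> \<alpha> j\<close>; being continuous at the origin, it vanishes.\<close>

lemma hfield_partial_zero:
  assumes i: "\<alpha> i = 1" and jl: "\<alpha> j \<le> \<alpha> l"
  shows "frechet_derivative (\<lambda>x. hfield gmul i x $ j) (at x) (axis l 1) = 0"
proof -
  let ?c = "\<lambda>x. hfield gmul i x $ j"
  let ?d = "\<lambda>x. frechet_derivative ?c (at x) (axis l 1)"
  have C1: "Ck_on (Suc 0) UNIV ?c"
    by (rule Ck_on_component[OF open_UNIV Ck_on_hfield])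
  then have der: "(?c has_derivative frechet_derivative ?c (at y)) (at y)" for y
    by (simp add: frechet_derivative_works)
  \<comment> \<open>As \<open>\<alpha> j \<le> \<alpha> l\<close>, the natural subtraction is exact
    and the exponent at least 1, so the power of r tends to 0 with r.\<close>
  have eq: "?d x = r ^ (\<alpha> l + 1 - \<alpha> j) * ?d (dilation \<alpha> r x)" if "0 < r" for r
  proof -
    have "((\<lambda>y. r * ?c (dilation \<alpha> r y)) has_derivative
        (\<lambda>v. r * frechet_derivative ?c (at (dilation \<alpha> r x)) (dilation \<alpha> r v))) (at x)"
      by (intro has_derivative_mult_right
          has_derivative_compose[OF bounded_linear_imp_has_derivative[OF bounded_linear_dilation] der])
    moreover have "((\<lambda>y. r ^ \<alpha> j * ?c y) has_derivative
        (\<lambda>v. r ^ \<alpha> j * frechet_derivative ?c (at x) v)) (at x)"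
      by (intro has_derivative_mult_right der)
    ultimately have "(\<lambda>v. r * frechet_derivative ?c (at (dilation \<alpha> r x)) (dilation \<alpha> r v))
        = (\<lambda>v. r ^ \<alpha> j * frechet_derivative ?c (at x) v)"
      unfolding hfield_dilation[OF that i] by (rule has_derivative_unique)
    then have "r * frechet_derivative ?c (at (dilation \<alpha> r x)) (dilation \<alpha> r (axis l 1))
        = r ^ \<alpha> j * ?d x" by metis
    then have "r * (r ^ \<alpha> l * ?d (dilation \<alpha> r x)) = r ^ \<alpha> j * ?d x"
      using linear_cmul[OF linear_frechet_derivative[OF differentiableI[OF der]]]
      by (simp add: dilation_axis)
    moreover have "r * r ^ \<alpha> l = r ^ \<alpha> j * r ^ (\<alpha> l + 1 - \<alpha> j)"
      using jl by (simp flip: power_add power_Suc)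
    ultimately have "r ^ \<alpha> j * (r ^ (\<alpha> l + 1 - \<alpha> j) * ?d (dilation \<alpha> r x)) = r ^ \<alpha> j * ?d x"
      by (simp only: mult.assoc[symmetric])
    then show ?thesis using that by simp
  qed
  have dil: "continuous_on UNIV (\<lambda>r. dilation \<alpha> r x)"
    unfolding dilation_def by (intro continuous_intros continuous_on_vec_lambda)
  have "continuous_on UNIV ?d" using C1 by simp
  then have "continuous_on UNIV (\<lambda>r. ?d (dilation \<alpha> r x))"
    by (rule continuous_on_compose2[OF _ dil]) auto
  then have "continuous_on UNIV (\<lambda>r. r ^ (\<alpha> l + 1 - \<alpha> j) * ?d (dilation \<alpha> r x))"
    by (intro continuous_intros)
  then have "((\<lambda>r. r ^ (\<alpha> l + 1 - \<alpha> j) * ?d (dilation \<alpha> r x)) \<longlongrightarrow> 0 ^ (\<alpha> l + 1 - \<alpha> j) * ?d (dilation \<alpha> 0 x))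
      (at_right 0)"
    by (auto simp: continuous_on_def intro: tendsto_within_subset)
  moreover have "0 ^ (\<alpha> l + 1 - \<alpha> j) * ?d (dilation \<alpha> 0 x) = 0"
    using jl by (simp add: power_0_left)
  ultimately have "((\<lambda>r. r ^ (\<alpha> l + 1 - \<alpha> j) * ?d (dilation \<alpha> r x)) \<longlongrightarrow> 0) (at_right 0)"
    by (simp only:)
  moreover have "eventually (\<lambda>r. r ^ (\<alpha> l + 1 - \<alpha> j) * ?d (dilation \<alpha> r x) = ?d x) (at_right 0)"
    using eq by (auto simp: eventually_at_filter)
  ultimately have "((\<lambda>r::real. ?d x) \<longlongrightarrow> 0) (at_right 0)"
    by (rule Lim_transform_eventually)
  then show ?thesis by (simp add: tendsto_const_iff)
qed

text \<open>The j-th coefficient has zero j-th partial derivative, so X_i f is the sum of the j-th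
  partials of (coefficient times f), each with integral 0.\<close>

lemma integral_X_zero:
  assumes i: "\<alpha> i = 1" and S: "open S" "Ck_on (Suc 0) S f"
    and K: "compact K" "K \<subseteq> S" "\<And>x. x \<notin> K \<Longrightarrow> f x = 0"
  shows "(LINT x|lborel. X i f x) = 0"
proof -
  let ?c = "\<lambda>j x. hfield gmul i x $ j"
  have f: "Ck_on (Suc 0) UNIV f" by (rule Ck_on_extend_zero[OF S(1) K(1,2) S(2) K(3)])
  have c: "Ck_on (Suc 0) UNIV (?c j)" for j
    by (rule Ck_on_component[OF open_UNIV Ck_on_hfield])
  have cf: "Ck_on (Suc 0) UNIV (\<lambda>x. ?c j x * f x)" for j
    by (rule Ck_on_mult[OF open_UNIV c f])
  have prod: "frechet_derivative (\<lambda>x. ?c j x * f x) (at x) (axis j 1)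
      = ?c j x * frechet_derivative f (at x) (axis j 1)" for j x
  proof -
    have "((\<lambda>x. ?c j x * f x) has_derivative
      (\<lambda>v. ?c j x * frechet_derivative f (at x) v + frechet_derivative (?c j) (at x) v * f x)) (at x)"
      using c[of j] f by (intro has_derivative_mult) (auto simp: frechet_derivative_works)
    from frechet_derivative_at[OF this, symmetric] show ?thesis
      using hfield_partial_zero[OF i, of j j x] by simp
  qed
  have "X i f x = (\<Sum>j\<in>UNIV. frechet_derivative (\<lambda>x. ?c j x * f x) (at x) (axis j 1))" for x
    unfolding prod vf_apply_def by (rule frechet_derivative_components) (use f in simp)
  then have "(LINT x|lborel. X i f x)
      = (\<Sum>j\<in>UNIV. LINT x|lborel. frechet_derivative (\<lambda>x. ?c j x * f x) (at x) (axis j 1))"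
  proof (simp only:, intro Bochner_Integration.integral_sum integrable_compact_support[OF K(1)])
    show "continuous_on K (\<lambda>x. frechet_derivative (\<lambda>x. ?c j x * f x) (at x) (axis j 1))" for j
      using cf[of j] by (auto intro: continuous_on_subset)
    show "frechet_derivative (\<lambda>x. ?c j x * f x) (at x) (axis j 1) = 0" if "x \<notin> K" for x j
      by (rule frechet_derivative_zero_outside[OF compact_imp_closed[OF K(1)] _ that]) (simp add: K(3))
  qed
  also have "\<dots> = 0"
    by (intro sum.neutral ballI integral_directional_derivative[OF cf K(1)]) (simp add: K(3))
  finally show ?thesis .
qed

end

section \<open>The homogeneous norm off the origin\<close>

text \<open>The set where \<open>f\<close> is nonzero is open and nonempty, hence not a null
  set.\<close>

lemma integral_pos_continuous:
  fixes f :: "'a::euclidean_space \<Rightarrow> real"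
  assumes "continuous_on UNIV f" "integrable lborel f" "\<And>x. 0 \<le> f x" "0 < f a"
  shows "0 < (LINT x|lborel. f x)"
proof -
  let ?S = "{x. f x \<noteq> 0}"
  have "open ?S" using assms(1) by (intro open_Collect_neq continuous_on_const)
  moreover have "a \<in> ?S" using assms(4) by simp
  ultimately have "\<not> negligible ?S" by (auto dest: open_not_negligible)
  then have "?S \<notin> null_sets lborel"
    using negligible_iff_null_sets null_sets_completionI by blast
  moreover have "?S \<in> sets lborel" using \<open>open ?S\<close> by simp
  ultimately have "\<not> (AE x in lborel. f x = 0)"
    using AE_iff_null_sets[of ?S lborel] by simp
  then have "(LINT x|lborel. f x) \<noteq> 0"
    using integral_nonneg_eq_0_iff_AE[OF assms(2)] assms(3) by auto
  moreover have "0 \<le> (LINT x|lborel. f x)" using assms(3) by simp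
  ultimately show ?thesis by simp
qed

text \<open>The function |t|^p is C^1 even at 0 when p > 1, so |phi|^p is an admissible function in
  the integral identities.\<close>

lemma abs_powr_derivative:
  fixes p t :: real
  assumes "1 < p"
  shows "((\<lambda>t. \<bar>t\<bar> powr p) has_real_derivative p * (sgn t * \<bar>t\<bar> powr (p - 1))) (at t)"
    and "continuous_on UNIV (\<lambda>t::real. sgn t * \<bar>t\<bar> powr (p - 1))"
proof -
  \<comment> \<open>Splitting into positive and negative parts removes the discontinuous
    \<open>sgn\<close>.\<close>
  have eq: "sgn t * \<bar>t\<bar> powr (p - 1) = max t 0 powr (p - 1) - max (- t) 0 powr (p - 1)" for t :: real
    by (cases "t = 0") (auto simp: sgn_if max_def)
  show cont: "continuous_on UNIV (\<lambda>t::real. sgn t * \<bar>t\<bar> powr (p - 1))"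
    unfolding eq using assms
    by (intro continuous_on_diff continuous_on_powr' continuous_intros) auto
  show "((\<lambda>t. \<bar>t\<bar> powr p) has_real_derivative p * (sgn t * \<bar>t\<bar> powr (p - 1))) (at t)"
  proof (cases "t = 0")
    case True
    have "((\<lambda>h::real. sgn h * \<bar>h\<bar> powr (p - 1)) \<longlongrightarrow> sgn 0 * \<bar>0\<bar> powr (p - 1)) (at 0)"
      using cont[unfolded continuous_on_def, rule_format, of 0] by (simp only: UNIV_I)
    then have lim: "((\<lambda>h::real. sgn h * \<bar>h\<bar> powr (p - 1)) \<longlongrightarrow> 0) (at 0)"
      by simp
    \<comment> \<open>The difference quotient at 0 is the claimed derivative up to the factor p, so
      its limit follows from the continuity just shown.\<close>
    have "sgn h * \<bar>h\<bar> powr (p - 1) = \<bar>h\<bar> powr p / h" if "h \<noteq> 0" for h :: real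
      using that by (auto simp: sgn_if powr_diff)
    then have "((\<lambda>h::real. \<bar>h\<bar> powr p / h) \<longlongrightarrow> 0) (at 0)"
      by (intro Lim_transform_eventually[OF lim]) (auto simp: eventually_at_filter)
    then show ?thesis using True by (simp add: has_field_derivative_iff)
  next
    case False
    have "((\<lambda>t. \<bar>t\<bar>) has_real_derivative sgn t) (at t)"
    proof -
      have "((\<lambda>h. sgn t * h) has_real_derivative sgn t) (at t)"
        by (auto intro!: derivative_eq_intros)
      then show ?thesis
        by (rule has_field_derivative_transform_within_open[where S = "if 0 < t then {0<..} else {..<0}"])
           (use False in \<open>auto simp: sgn_if split: if_splits\<close>)
    qed
    from DERIV_chain2[OF has_real_derivative_powr this, of p] show ?thesis
      using False by (simp add: mult_ac)
  qed
qed

text \<open>Young's inequality with conjugate exponents p/(p-1) and p. The parameter c is placed so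
  that equality holds for b = c a, the relation satisfied by the virtual extremal.\<close>

lemma young_powr:
  fixes a b c p :: real
  assumes "1 < p" "0 < c" "0 \<le> a" "0 \<le> b"
  shows "p * a powr (p - 1) * b \<le> (p - 1) * c * a powr p + c powr (1 - p) * b powr p"
proof (cases "a = 0 \<or> b = 0")
  case False
  define s where "s = (p - 1) / p"
  have s: "0 \<le> s" "s + 1 / p = 1" using assms(1) by (auto simp: s_def field_simps)
  have ps: "p * s = p - 1" using assms(1) by (simp add: s_def)
  have "(c * a powr p) powr s * (c powr (1 - p) * b powr p) powr (1 / p)
      \<le> s * (c * a powr p) + 1 / p * (c powr (1 - p) * b powr p)"
    by (rule Youngs_inequality_0) (use s assms False in auto)
  moreover have "(c * a powr p) powr s = c powr s * a powr (p - 1)"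
    using assms ps by (simp add: powr_mult powr_powr)
  moreover have "(c powr (1 - p) * b powr p) powr (1 / p) = c powr (- s) * b"
    using assms by (simp add: powr_mult powr_powr s_def minus_divide_left)
  moreover have "c powr s * a powr (p - 1) * (c powr (- s) * b) = a powr (p - 1) * b"
    using assms(2) by (simp add: powr_minus field_simps)
  ultimately have "p * (a powr (p - 1) * b)
      \<le> p * (s * (c * a powr p) + 1 / p * (c powr (1 - p) * b powr p))"
    using assms(1) by (intro mult_left_mono) auto
  also have "\<dots> = (p * s) * c * a powr p + c powr (1 - p) * b powr p"
    using assms(1) by (simp add: algebra_simps)
  finally show ?thesis unfolding ps by (simp add: mult.assoc)
qed (use assms in auto)

text \<open>\<open>flat 1\<close> is composed with r^2 - |x - x0|^2, a polynomial that is positive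
  exactly in the open ball.\<close>

lemma exists_bump:
  fixes x0 :: "real^'n::finite"
  assumes "open U" "x0 \<in> U"
  obtains \<phi> where "test_function U \<phi>" "\<And>x. 0 \<le> \<phi> x" "0 < \<phi> x0"
proof -
  obtain r where r: "0 < r" "cball x0 r \<subseteq> U"
    using assms open_contains_cball by blast
  define q where "q x = r\<^sup>2 - (x - x0) \<bullet> (x - x0)" for x
  define \<phi> where "\<phi> x = flat 1 (q x)" for x
  have "Ck_on l UNIV (\<lambda>x. x $ j - x0 $ j)" for l j
    by (intro Ck_on_diff Ck_on_const Ck_on_bounded_linear bounded_linear_vec_nth open_UNIV)
  then have "Ck_on l UNIV (\<lambda>x. \<Sum>j\<in>UNIV. (x $ j - x0 $ j) * (x $ j - x0 $ j))" for l
    by (intro Ck_on_sum[OF open_UNIV] Ck_on_mult[OF open_UNIV])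
  then have "Ck_on l UNIV q" for l
    unfolding q_def inner_vec_def inner_real_def vector_minus_component
    by (rule Ck_on_diff[OF open_UNIV Ck_on_const])
  then have smooth: "smooth_on UNIV \<phi>"
    unfolding smooth_on_def \<phi>_def
    by (intro allI Ck_on_compose[OF open_UNIV UNIV_I _ Ck_on_flat])
  have "x \<in> cball x0 r" if "\<phi> x \<noteq> 0" for x
  proof -
    have "(norm (x - x0))\<^sup>2 < r\<^sup>2"
      using that by (simp add: \<phi>_def q_def flat_def power2_norm_eq_inner split: if_splits)
    then have "norm (x - x0) < r" using r(1) by (simp add: power2_less_imp_less)
    then show ?thesis by (simp add: dist_norm norm_minus_commute)
  qed
  then have "closure {x. \<phi> x \<noteq> 0} \<subseteq> cball x0 r"
    by (intro closure_minimal) auto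
  moreover from this have "compact (closure {x. \<phi> x \<noteq> 0})"
    using compact_cball bounded_subset compact_eq_bounded_closed by blast
  ultimately have "test_function U \<phi>"
    unfolding test_function_def using smooth r(2) by auto
  moreover have "0 \<le> \<phi> x" for x by (simp add: \<phi>_def flat_def)
  moreover have "0 < \<phi> x0" using r(1) by (simp add: \<phi>_def flat_def q_def)
  ultimately show ?thesis by (rule that)
qed

section \<open>Horizontal gradient and Green's identity\<close>

context carnot_group
begin

abbreviation H :: "'n set" where "H \<equiv> {i. \<alpha> i = 1}"

abbreviation grad :: "(real^'n \<Rightarrow> real) \<Rightarrow> real^'n \<Rightarrow> real^'n" where
  "grad \<equiv> hgrad gmul \<alpha>"

abbreviation laplacian :: "(real^'n \<Rightarrow> real) \<Rightarrow> real^'n \<Rightarrow> real" where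
  "laplacian \<equiv> sub_laplacian gmul \<alpha>"

lemma grad_inner: "grad f x \<bullet> grad g x = (\<Sum>i\<in>H. X i f x * X i g x)"
proof -
  have "grad f x \<bullet> grad g x = (\<Sum>i\<in>UNIV. if i \<in> H then X i f x * X i g x else 0)"
    unfolding inner_vec_def by (rule sum.cong) (auto simp: hgrad_def)
  then show ?thesis by (simp add: sum.If_cases)
qed

lemma norm_grad_sq: "(norm (grad f x))\<^sup>2 = (\<Sum>i\<in>H. (X i f x)\<^sup>2)"
  unfolding power2_norm_eq_inner grad_inner by (simp add: power2_eq_square)

lemma Ck_on_X: "open S \<Longrightarrow> Ck_on (Suc l) S f \<Longrightarrow> Ck_on l S (X i f)"
  using Ck_on_subset[OF Ck_on_hfield subset_UNIV] by (intro Ck_on_vf_apply)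

lemma continuous_on_grad:
  assumes "open S" "Ck_on (Suc 0) S f"
  shows "continuous_on S (grad f)"
proof -
  have "continuous_on S (X i f)" for i
    using Ck_on_X[OF assms] by simp
  then have "continuous_on S (\<lambda>x. if \<alpha> i = 1 then X i f x else 0)" for i
    by (cases "\<alpha> i = 1") auto
  then show ?thesis unfolding hgrad_def[abs_def] by (intro continuous_on_vec_lambda)
qed

lemma X_zero_outside:
  "closed K \<Longrightarrow> (\<And>x. x \<notin> K \<Longrightarrow> f x = 0) \<Longrightarrow> x \<notin> K \<Longrightarrow> X i f x = 0"
  unfolding vf_apply_def by (rule frechet_derivative_zero_outside)

lemma grad_zero_outside:
  "closed K \<Longrightarrow> (\<And>x. x \<notin> K \<Longrightarrow> f x = 0) \<Longrightarrow> x \<notin> K \<Longrightarrow> grad f x = 0"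
  by (simp add: vec_eq_iff hgrad_def X_zero_outside)

lemma grad_compose:
  assumes "f differentiable (at x)" "(h has_real_derivative h') (at (f x))"
  shows "grad (\<lambda>x. h (f x)) x = h' *\<^sub>R grad f x"
  using vf_apply_compose[OF assms] by (simp add: vec_eq_iff hgrad_def)

text \<open>f X_i X_i g - g X_i X_i f = X_i (f X_i g - g X_i f), and the right-hand side integrates
  to 0. Only \<open>g\<close> is compactly supported, so \<open>f\<close> may be singular at the
  origin.\<close>

lemma laplacian_greens:
  assumes S: "open S" "Ck_on 2 S f" "Ck_on 2 S g"
    and K: "compact K" "K \<subseteq> S" "\<And>x. x \<notin> K \<Longrightarrow> g x = 0"
  shows "(LINT x|lborel. f x * laplacian g x) = (LINT x|lborel. g x * laplacian f x)"
proof -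
  note cl = compact_imp_closed[OF K(1)]
  have C: "Ck_on (Suc (Suc 0)) S f" "Ck_on (Suc (Suc 0)) S g"
    using S by (simp_all only: numeral_2_eq_2)
  have C1: "Ck_on (Suc 0) S f" "Ck_on (Suc 0) S g"
    using C Ck_on_SucD by blast+
  have CX: "Ck_on (Suc 0) S (X i f)" "Ck_on (Suc 0) S (X i g)" for i
    using C by (auto intro: Ck_on_X[OF S(1)] simp del: Ck_on.simps)
  have CXX: "continuous_on S (X i (X i f))" "continuous_on S (X i (X i g))" for i
    using Ck_on_X[OF S(1) CX(1)] Ck_on_X[OF S(1) CX(2)] by simp_all
  define G where "G i x = f x * X i g x - g x * X i f x" for i x
  have X0: "X i g x = 0" if "x \<notin> K" for i x
    by (rule X_zero_outside[OF cl K(3) that])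
  have XX0: "X i (X i g) x = 0" if "x \<notin> K" for i x
    by (rule X_zero_outside[OF cl X0 that])
  have "(LINT x|lborel. X i (G i) x) = 0" if "i \<in> H" for i
  proof (rule integral_X_zero[OF _ S(1) _ K(1,2)])
    show "\<alpha> i = 1" using that by simp
    show "Ck_on (Suc 0) S (G i)"
      unfolding G_def by (intro Ck_on_diff Ck_on_mult S(1) C1 CX)
    show "G i x = 0" if "x \<notin> K" for x
      using that X0 K(3) by (simp add: G_def)
  qed
  moreover have XG: "X i (G i) x = f x * X i (X i g) x - g x * X i (X i f) x" for i x
  proof (cases "x \<in> S")
    case True
    have d: "f differentiable (at x)" "g differentiable (at x)" "X i f differentiable (at x)"
      "X i g differentiable (at x)"
      using C1 CX True by auto
    have "X i (G i) x = X i (\<lambda>x. f x * X i g x) x - X i (\<lambda>x. g x * X i f x) x"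
      unfolding G_def using d by (intro vf_apply_diff differentiable_mult)
    then show ?thesis using d by (simp add: vf_apply_mult)
  next
    case False
    then have "x \<notin> K" using K(2) by auto
    have "X i (G i) x = 0"
      by (rule X_zero_outside[OF cl _ \<open>x \<notin> K\<close>]) (simp add: G_def X0 K(3))
    then show ?thesis using \<open>x \<notin> K\<close> K(3) XX0 by simp
  qed
  moreover have i1: "integrable lborel (\<lambda>x. f x * X i (X i g) x)" for i
    by (rule integrable_compact_support[OF K(1)])
       (use XX0 continuous_on_subset[OF continuous_on_mult[OF Ck_on_imp_continuous_on[OF C1(1)] CXX(2)] K(2)] in auto)
  moreover have i2: "integrable lborel (\<lambda>x. g x * X i (X i f) x)" for i
    by (rule integrable_compact_support[OF K(1)])
       (use K(3) continuous_on_subset[OF continuous_on_mult[OF Ck_on_imp_continuous_on[OF C1(2)] CXX(1)] K(2)] in auto)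
  ultimately have "(LINT x|lborel. f x * X i (X i g) x) = (LINT x|lborel. g x * X i (X i f) x)"
    if "i \<in> H" for i using that by simp
  then show ?thesis
    unfolding sub_laplacian_def sum_distrib_left using i1 i2 by simp
qed

end

section \<open>The equation satisfied by N away from the origin\<close>

locale polarizable_carnot = carnot_group gmul ginv \<alpha> k
  for gmul :: "real^'n::finite \<Rightarrow> real^'n \<Rightarrow> real^'n" and ginv :: "real^'n \<Rightarrow> real^'n"
    and \<alpha> :: "'n \<Rightarrow> nat" and k :: nat +
  fixes Q :: nat and u N :: "real^'n \<Rightarrow> real"
  assumes Q_ge: "3 \<le> Q" and folland: "folland_solution gmul ginv \<alpha> Q u"
    and N_eq: "N = norm_of Q u" and polarizable: "polarizable gmul \<alpha> N"
begin

lemma hom_norm: "homogeneous_norm ginv \<alpha> N"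
  using folland by (simp add: folland_solution_def N_eq)

lemma N_nonneg: "0 \<le> N x" and N_eq_0 [simp]: "N x = 0 \<longleftrightarrow> x = 0"
  and N_continuous: "continuous_on UNIV N"
  and Ck_on_N: "Ck_on l (- {0}) N"
  and N_dilation: "0 < r \<Longrightarrow> N (dilation \<alpha> r x) = r * N x"
  using hom_norm by (auto simp: homogeneous_norm_def smooth_on_def)

lemma N_0 [simp]: "N 0 = 0"
  by simp

lemma N_pos: "x \<noteq> 0 \<Longrightarrow> 0 < N x"
  using N_nonneg[of x] N_eq_0[of x] by linarith

lemma N_differentiable: "x \<noteq> 0 \<Longrightarrow> N differentiable (at x)"
  using Ck_on_N[of "Suc 0"] by simp

lemma Ck_on_N_powr: "Ck_on l (- {0}) (\<lambda>x. N x powr a)"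
  by (rule Ck_on_compose[OF _ _ Ck_on_N Ck_on_powr]) (auto simp: N_pos)

lemma u_eq: "x \<noteq> 0 \<Longrightarrow> u x = N x powr (2 - real Q)"
  using folland Q_ge by (auto simp: N_eq norm_of_def folland_solution_def powr_powr intro: less_imp_le)

text \<open>Off the origin this function is \<open>u\<close>, harmonic there in the distributional
  sense. Were its sub-Laplacian nonzero at \<open>x0\<close>, a bump supported where the sign
  persists would give an integral that is both zero and positive.\<close>

lemma N_powr_harmonic:
  assumes "x0 \<noteq> 0"
  shows "laplacian (\<lambda>x. N x powr (2 - real Q)) x0 = 0"
proof (rule ccontr)
  let ?v = "\<lambda>x. N x powr (2 - real Q)" and ?S = "- {0::real^'n}"
  assume nz: "laplacian ?v x0 \<noteq> 0"
  have S: "open ?S" by auto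
  have cont: "continuous_on ?S (laplacian ?v)"
    unfolding sub_laplacian_def[abs_def] using Ck_on_N_powr
    by (intro continuous_on_sum Ck_on_imp_continuous_on[of 0] Ck_on_X S)
  \<comment> \<open>The sign factor treats a positive and a negative value at \<open>x0\<close>
    together.\<close>
  define s where "s = sgn (laplacian ?v x0)"
  define U where "U = {x \<in> ?S. s * laplacian ?v x > 0}"
  have U: "open U" "x0 \<in> U" "U \<subseteq> ?S"
  proof -
    have "U = ?S \<inter> (\<lambda>x. s * laplacian ?v x) -` {0<..}" by (auto simp: U_def)
    moreover have "open (?S \<inter> (\<lambda>x. s * laplacian ?v x) -` {0<..})"
      by (intro continuous_open_preimage continuous_intros cont S open_greaterThan)
    ultimately show "open U" by simp
    show "x0 \<in> U" using assms nz by (simp add: U_def s_def sgn_if)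
  qed (auto simp: U_def)
  obtain \<phi> where \<phi>: "test_function U \<phi>" "\<And>x. 0 \<le> \<phi> x" "0 < \<phi> x0"
    using exists_bump[OF U(1,2)] by blast
  define K where "K = closure {x. \<phi> x \<noteq> 0}"
  have K: "compact K" "K \<subseteq> U" "\<And>x. x \<notin> K \<Longrightarrow> \<phi> x = 0"
    using \<phi>(1) closure_subset[of "{x. \<phi> x \<noteq> 0}"] by (auto simp: test_function_def K_def)
  have sm: "Ck_on l T \<phi>" for l T
    using \<phi>(1) Ck_on_subset[OF _ subset_UNIV] by (auto simp: test_function_def smooth_on_def)
  have "0 \<notin> K" using K(2) U(3) by auto
  note cl = compact_imp_closed[OF K(1)]
  have "X i \<phi> x = 0" if "x \<notin> K" for i x
    by (rule X_zero_outside[OF cl K(3) that])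
  \<comment> \<open>\<open>u\<close> and \<open>?v\<close> may differ at the origin, but the support
    of \<open>\<phi>\<close> avoids it, so \<open>laplacian \<phi>\<close> vanishes there and the
    two integrands agree everywhere.\<close>
  then have "X i (X i \<phi>) 0 = 0" for i
    by (rule X_zero_outside[OF cl _ \<open>0 \<notin> K\<close>])
  then have "laplacian \<phi> 0 = 0"
    by (simp add: sub_laplacian_def)
  then have "(\<lambda>x. u x * laplacian \<phi> x) = (\<lambda>x. ?v x * laplacian \<phi> x)"
    by (intro ext) (metis mult_zero_right u_eq)
  moreover have "test_function UNIV \<phi>" using \<phi>(1) by (auto simp: test_function_def)
  then have "- (LINT x|lborel. u x * laplacian \<phi> x) = \<phi> 0"
    using folland by (simp add: folland_solution_def fundamental_solution_def)
  ultimately have "(LINT x|lborel. ?v x * laplacian \<phi> x) = 0"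
    using K(3) \<open>0 \<notin> K\<close> by simp
  moreover have "(LINT x|lborel. ?v x * laplacian \<phi> x) = (LINT x|lborel. \<phi> x * laplacian ?v x)"
    by (rule laplacian_greens[OF S Ck_on_N_powr sm K(1) _ K(3)]) (use K(2) U(3) in auto)
  ultimately have "(LINT x|lborel. \<phi> x * laplacian ?v x) = 0" by simp
  then have zero: "(LINT x|lborel. s * (\<phi> x * laplacian ?v x)) = 0" by simp
  have c0: "Ck_on 0 ?S (\<lambda>x. s * (\<phi> x * laplacian ?v x))"
    using cont sm[of 0 ?S] by (auto intro!: continuous_intros)
  have "0 < (LINT x|lborel. s * (\<phi> x * laplacian ?v x))"
  proof (rule integral_pos_continuous)
    show "continuous_on UNIV (\<lambda>x. s * (\<phi> x * laplacian ?v x))"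
      using Ck_on_extend_zero[OF S K(1) _ c0] K(2,3) U(3) by auto
    show "integrable lborel (\<lambda>x. s * (\<phi> x * laplacian ?v x))"
      by (rule integrable_compact_support[OF K(1)])
         (use c0 K(2,3) U(3) in \<open>auto intro: continuous_on_subset\<close>)
    show "0 \<le> s * (\<phi> x * laplacian ?v x)" for x
    proof (cases "x \<in> K")
      case True
      then have "0 \<le> s * laplacian ?v x"
        using K(2) by (auto simp: U_def)
      from mult_nonneg_nonneg[OF \<phi>(2) this, of x] show ?thesis by (simp only: mult_ac)
    qed (simp add: K(3))
    have "0 < s * laplacian ?v x0"
      using U(2) by (auto simp: U_def)
    from mult_pos_pos[OF \<phi>(3) this] show "0 < s * (\<phi> x0 * laplacian ?v x0)" by (simp only: mult_ac)
  qed
  with zero show False by (simp only: less_irrefl)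
qed

lemma X_N_powr:
  assumes "x \<noteq> 0"
  shows "X i (\<lambda>x. N x powr a) x = a * N x powr (a - 1) * X i N x"
  by (rule vf_apply_compose[OF N_differentiable[OF assms]
        has_real_derivative_powr[OF N_pos[OF assms]]])

text \<open>For q = 2 - Q the chain rule expands the sub-Laplacian of N^q as q N^(q-2) times
  (q-1)|grad N|^2 + N laplacian N. It vanishes and q is nonzero, so the bracket is 0.\<close>

lemma laplacian_N:
  assumes "x \<noteq> 0"
  shows "laplacian N x = (real Q - 1) * (norm (grad N x))\<^sup>2 / N x"
proof -
  let ?q = "2 - real Q"
  have S: "open (- {0::real^'n})" by auto
  have N: "N differentiable (at x)" "0 < N x" using assms N_differentiable N_pos by auto
  have CXN: "Ck_on (Suc 0) (- {0}) (X i N)" for i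
    by (rule Ck_on_X[OF S Ck_on_N])
  have "X i (X i (\<lambda>x. N x powr ?q)) x
      = ?q * N x powr (?q - 2) * ((?q - 1) * (X i N x)\<^sup>2 + N x * X i (X i N) x)" for i
  proof -
    have "Ck_on (Suc 0) (- {0}) (X i (\<lambda>x. N x powr ?q))"
      by (rule Ck_on_X[OF S Ck_on_N_powr])
    then have "X i (X i (\<lambda>x. N x powr ?q)) x = X i (\<lambda>x. (?q * N x powr (?q - 1)) * X i N x) x"
      using assms by (intro vf_apply_cong[OF S]) (auto simp: X_N_powr)
    also have "\<dots> = ?q * N x powr (?q - 1) * X i (X i N) x
        + X i (\<lambda>x. ?q * N x powr (?q - 1)) x * X i N x"
    proof (rule vf_apply_mult)
      show "(\<lambda>x. ?q * N x powr (?q - 1)) differentiable (at x)"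
        using Ck_on_differentiable[OF Ck_on_mult[OF S Ck_on_const Ck_on_N_powr]] assms by blast
      show "X i N differentiable (at x)"
        using Ck_on_differentiable[OF CXN] assms by blast
    qed
    also have "X i (\<lambda>x. ?q * N x powr (?q - 1)) x = ?q * ((?q - 1) * N x powr (?q - 1 - 1)) * X i N x"
      by (rule vf_apply_compose[OF N(1) DERIV_cmult[OF has_real_derivative_powr[OF N(2)]]])
    also have "N x powr (?q - 1) = N x powr (?q - 2) * N x"
      using N(2) by (simp add: powr_mult_base mult.commute)
    finally show ?thesis by (simp add: algebra_simps power2_eq_square)
  qed
  then have "?q * N x powr (?q - 2) * ((?q - 1) * (norm (grad N x))\<^sup>2 + N x * laplacian N x) = 0"
    using N_powr_harmonic[OF assms]
    unfolding sub_laplacian_def norm_grad_sq sum_distrib_left sum.distrib[symmetric] by simp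
  moreover have "?q * N x powr (?q - 2) \<noteq> 0" using Q_ge assms by simp
  ultimately have "(?q - 1) * (norm (grad N x))\<^sup>2 + N x * laplacian N x = 0"
    by (metis mult_eq_0_iff)
  then show ?thesis using assms by (simp add: field_simps)
qed

end

section \<open>The Hardy inequality\<close>

context polarizable_carnot
begin

lemma open_punctured: "open (- {0::real^'n})"
  by auto

abbreviation g :: "real^'n \<Rightarrow> real" where "g x \<equiv> norm (grad N x)"

lemma Ck_on_X_N: "Ck_on l (- {0}) (X i N)"
  by (rule Ck_on_X[OF open_punctured Ck_on_N])

lemma Ck_on_g_sq: "Ck_on l (- {0}) (\<lambda>x. (g x)\<^sup>2)"
  unfolding norm_grad_sq unfolding power2_eq_square
  by (intro Ck_on_sum Ck_on_mult Ck_on_X_N open_punctured)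

lemma continuous_on_grad_N: "continuous_on (- {0}) (grad N)"
  by (rule continuous_on_grad[OF open_punctured Ck_on_N])

lemma continuous_on_N_powr: "continuous_on (- {0}) (\<lambda>x. N x powr a)"
  using Ck_on_N_powr[of 0] by simp

lemma g_sq_orthogonal:
  assumes "x \<noteq> 0"
  shows "(\<Sum>i\<in>H. X i (\<lambda>x. (g x)\<^sup>2) x * X i N x) = 0"
  using polarizable assms
  by (simp add: polarizable_def inf_sub_laplacian_def grad_inner)

text \<open>A regularization of |grad N|^(p-2) N^(1-p): for \<open>e > 0\<close> the base of the
  first power stays positive, so the weight is smooth even where \<open>grad N\<close>
  vanishes.\<close>

definition weight :: "real \<Rightarrow> real \<Rightarrow> real^'n \<Rightarrow> real" where
  "weight p e x = ((g x)\<^sup>2 + e) powr ((p - 2) / 2) * N x powr (1 - p)"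

lemma Ck_on_g_sq_powr:
  assumes "0 < e"
  shows "Ck_on l (- {0}) (\<lambda>x. ((g x)\<^sup>2 + e) powr a)"
proof -
  have "(g x)\<^sup>2 + e \<in> {0<..}" for x
    using assms by (simp add: add_nonneg_pos)
  then show ?thesis
    by (rule Ck_on_compose[OF open_punctured _ Ck_on_add[OF open_punctured Ck_on_g_sq Ck_on_const] Ck_on_powr])
qed

lemma Ck_on_weight:
  assumes "0 < e"
  shows "Ck_on l (- {0}) (weight p e)"
  unfolding weight_def[abs_def]
  by (rule Ck_on_mult[OF open_punctured Ck_on_g_sq_powr[OF assms] Ck_on_N_powr])

text \<open>The derivative of the first factor of the weight drops out because
  \<open>\<nabla>\<^sub>G|\<nabla>\<^sub>GN|\<^sup>2\<close> is orthogonal to \<open>\<nabla>\<^sub>GN\<close>; this is where polarizability enters.\<close>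

lemma divergence_weight_grad:
  assumes "0 < e" "x \<noteq> 0"
  shows "(\<Sum>i\<in>H. X i (\<lambda>x. weight p e x * X i N x) x) = (real Q - p) * weight p e x * (g x)\<^sup>2 / N x"
proof -
  let ?a = "(p - 2) / 2" and ?h = "\<lambda>x. (g x)\<^sup>2 + e"
  let ?W = "\<lambda>x. ?h x powr ?a"
  have pos: "0 < ?h x" using assms(1) by (simp add: add_nonneg_pos)
  have N: "N differentiable (at x)" "0 < N x" using assms N_differentiable N_pos by auto
  have h: "?h differentiable (at x)"
    using Ck_on_differentiable[OF Ck_on_add[OF open_punctured Ck_on_g_sq Ck_on_const]] assms(2) by blast
  have Np: "(\<lambda>x. N x powr (1 - p)) differentiable (at x)"
    using Ck_on_differentiable[OF Ck_on_N_powr] assms(2) by blast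
  have W: "?W differentiable (at x)"
    using Ck_on_differentiable[OF Ck_on_g_sq_powr[OF assms(1)]] assms(2) by blast
  have XW: "X i ?W x = ?a * ?h x powr (?a - 1) * X i (\<lambda>x. (g x)\<^sup>2) x" for i
  proof -
    have "X i ?W x = ?a * ?h x powr (?a - 1) * X i ?h x"
      by (rule vf_apply_compose[OF h has_real_derivative_powr[OF pos]])
    moreover have "X i ?h x = 1 * X i (\<lambda>x. (g x)\<^sup>2) x"
      by (rule vf_apply_compose[where h = "\<lambda>t. t + e"])
         (use Ck_on_differentiable[OF Ck_on_g_sq] assms(2) in \<open>auto intro!: derivative_eq_intros\<close>)
    ultimately show ?thesis by simp
  qed
  have Xw: "X i (weight p e) x = ?W x * ((1 - p) * N x powr (- p) * X i N x) + X i ?W x * N x powr (1 - p)" for i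
    unfolding weight_def[abs_def] using vf_apply_mult[OF W Np, of "hfield gmul i"] X_N_powr[OF assms(2), of i "1 - p"]
    by simp
  have "X i (\<lambda>x. weight p e x * X i N x) x = weight p e x * X i (X i N) x + X i (weight p e) x * X i N x" for i
    by (intro vf_apply_mult Ck_on_differentiable[OF Ck_on_weight] Ck_on_differentiable[OF Ck_on_X_N])
       (use assms in auto)
  then have "X i (\<lambda>x. weight p e x * X i N x) x = weight p e x * X i (X i N) x
      + ?W x * (1 - p) * N x powr (- p) * (X i N x)\<^sup>2 + X i ?W x * X i N x * N x powr (1 - p)" for i
    unfolding Xw by (simp add: algebra_simps power2_eq_square)
  then have "(\<Sum>i\<in>H. X i (\<lambda>x. weight p e x * X i N x) x)
      = weight p e x * laplacian N x + ?W x * (1 - p) * N x powr (- p) * (\<Sum>i\<in>H. (X i N x)\<^sup>2)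
        + (\<Sum>i\<in>H. X i ?W x * X i N x) * N x powr (1 - p)"
    by (simp only: sub_laplacian_def sum_distrib_left sum_distrib_right sum.distrib)
  also have "(\<Sum>i\<in>H. (X i N x)\<^sup>2) = (g x)\<^sup>2"
    by (rule norm_grad_sq[symmetric])
  also have "(\<Sum>i\<in>H. X i ?W x * X i N x) = 0"
    unfolding XW mult.assoc sum_distrib_left[symmetric] g_sq_orthogonal[OF assms(2)] by simp
  \<comment> \<open>Now both remaining terms carry
    \<open>weight p e x * (g x)\<^sup>2 / N x\<close>, with coefficients Q - 1 and 1 - p.\<close>
  also have "N x powr (- p) = N x powr (1 - p) / N x"
    using N(2) by (simp add: powr_diff powr_minus field_simps)
  finally show ?thesis
    unfolding laplacian_N[OF assms(2)] weight_def by (simp add: algebra_simps diff_divide_distrib)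
qed

text \<open>The divergence theorem for the field psi * weight * grad N: by the product rule and
  \<open>divergence_weight_grad\<close> the integrand is a sum of terms X_i (F i), each with
  integral 0.\<close>

lemma regularized_identity:
  assumes e: "0 < e" and \<psi>: "Ck_on (Suc 0) (- {0}) \<psi>"
    and K: "compact K" "K \<subseteq> - {0}" "\<And>x. x \<notin> K \<Longrightarrow> \<psi> x = 0"
  shows "(LINT x|lborel. weight p e x * (grad \<psi> x \<bullet> grad N x)
            + (real Q - p) * \<psi> x * (weight p e x * (g x)\<^sup>2 / N x)) = 0"
proof -
  note cl = compact_imp_closed[OF K(1)]
  define F where "F i x = \<psi> x * (weight p e x * X i N x)" for i x
  have CV: "Ck_on (Suc 0) (- {0}) (\<lambda>x. weight p e x * X i N x)" for i
    by (rule Ck_on_mult[OF open_punctured Ck_on_weight[OF e] Ck_on_X_N])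
  have CF: "Ck_on (Suc 0) (- {0}) (F i)" for i
    unfolding F_def by (rule Ck_on_mult[OF open_punctured \<psi> CV])
  have F0: "F i x = 0" if "x \<notin> K" for i x
    using K(3)[OF that] by (simp add: F_def)
  have "weight p e x * (grad \<psi> x \<bullet> grad N x) + (real Q - p) * \<psi> x * (weight p e x * (g x)\<^sup>2 / N x)
      = (\<Sum>i\<in>H. X i (F i) x)" for x
  proof (cases "x = 0")
    case True
    then have "x \<notin> K" using K(2) by auto
    then show ?thesis
      using X_zero_outside[OF cl F0] grad_zero_outside[OF cl K(3)] K(3) by simp
  next
    case False
    have "X i (F i) x = \<psi> x * X i (\<lambda>x. weight p e x * X i N x) x + X i \<psi> x * (weight p e x * X i N x)" for i
      unfolding F_def
      by (intro vf_apply_mult Ck_on_differentiable[OF \<psi>] Ck_on_differentiable[OF CV]) (use False in auto)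
    then have "(\<Sum>i\<in>H. X i (F i) x) = \<psi> x * (\<Sum>i\<in>H. X i (\<lambda>x. weight p e x * X i N x) x)
        + weight p e x * (\<Sum>i\<in>H. X i \<psi> x * X i N x)"
      by (simp add: sum.distrib sum_distrib_left mult_ac)
    then show ?thesis
      unfolding grad_inner divergence_weight_grad[OF e False] by (simp add: mult_ac)
  qed
  moreover have "(LINT x|lborel. (\<Sum>i\<in>H. X i (F i) x)) = (\<Sum>i\<in>H. LINT x|lborel. X i (F i) x)"
  proof (intro Bochner_Integration.integral_sum integrable_compact_support[OF K(1)])
    show "continuous_on K (X i (F i))" for i
      by (rule continuous_on_subset[OF Ck_on_imp_continuous_on[OF Ck_on_X[OF open_punctured CF]] K(2)])
    show "X i (F i) x = 0" if "x \<notin> K" for i x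
      by (rule X_zero_outside[OF cl F0 that])
  qed
  moreover have "(LINT x|lborel. X i (F i) x) = 0" if "i \<in> H" for i
    by (rule integral_X_zero[OF _ open_punctured CF K(1,2) F0]) (use that in auto)
  ultimately show ?thesis by simp
qed

section \<open>Removing the regularization\<close>

lemma integrable_punctured:
  fixes f :: "real^'n \<Rightarrow> real"
  assumes "compact K" "K \<subseteq> - {0}" "\<And>x. x \<notin> K \<Longrightarrow> f x = 0" "continuous_on (- {0}) f"
  shows "integrable lborel f"
  using assms by (intro integrable_compact_support[OF assms(1)]) (auto intro: continuous_on_subset)

text \<open>The limit e -> 0 of \<open>regularized_identity\<close>, by dominated convergence along
  e = 1/(n+1).\<close>

lemma weighted_identity:
  assumes p: "1 < p" and \<psi>: "Ck_on (Suc 0) (- {0}) \<psi>"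
    and K: "compact K" "K \<subseteq> - {0}" "\<And>x. x \<notin> K \<Longrightarrow> \<psi> x = 0"
  defines "f \<equiv> \<lambda>x. g x powr (p - 2) * N x powr (1 - p) * (grad \<psi> x \<bullet> grad N x)
            + (real Q - p) * \<psi> x * (g x powr p / N x powr p)"
  shows "integrable lborel f" "(LINT x|lborel. f x) = 0"
proof -
  note cl = compact_imp_closed[OF K(1)]
  have grad0: "grad \<psi> x = 0" if "x \<notin> K" for x
    by (rule grad_zero_outside[OF cl K(3) that])
  have cont: "continuous_on (- {0}) \<psi>" "continuous_on (- {0}) (grad \<psi>)"
    using Ck_on_imp_continuous_on[OF \<psi>] continuous_on_grad[OF open_punctured \<psi>] by auto
  define e where "e n = inverse (real (Suc n))" for n
  have e: "0 < e n" "e n \<le> 1" for n by (auto simp: e_def divide_simps)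
  have e0: "e \<longlonglongrightarrow> 0" unfolding e_def by (rule LIMSEQ_inverse_real_of_nat)
  define F where "F n x = weight p (e n) x * (grad \<psi> x \<bullet> grad N x)
            + (real Q - p) * \<psi> x * (weight p (e n) x * (g x)\<^sup>2 / N x)" for n x
  \<comment> \<open>The dominating function: e is replaced by its upper bound 1 after each factor
    \<open>g x\<close> has been absorbed into the power.\<close>
  define B where "B x = ((g x)\<^sup>2 + 1) powr ((p - 1) / 2) * N x powr (1 - p) * norm (grad \<psi> x)
            + \<bar>real Q - p\<bar> * \<bar>\<psi> x\<bar> * (((g x)\<^sup>2 + 1) powr (p / 2) * N x powr (1 - p) / N x)" for x
  have cw: "continuous_on (- {0}) (weight p (e n))" for n
    using Ck_on_weight[OF e(1), of 0] by simp
  have cN: "continuous_on (- {0}) N" using Ck_on_N[of 0] by simp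
  have Fi: "integrable lborel (F n)" for n
  proof (rule integrable_punctured[OF K(1,2)])
    show "F n x = 0" if "x \<notin> K" for x
      using K(3)[OF that] grad0[OF that] by (simp add: F_def)
    show "continuous_on (- {0}) (F n)"
      unfolding F_def by (intro continuous_intros cw cont continuous_on_grad_N cN) auto
  qed
  have Bi: "integrable lborel B"
  proof (rule integrable_punctured[OF K(1,2)])
    show "B x = 0" if "x \<notin> K" for x
      using K(3)[OF that] grad0[OF that] by (simp add: B_def)
    have "(g x)\<^sup>2 + 1 \<noteq> 0" for x by (smt (verit) zero_le_power2)
    then show "continuous_on (- {0}) B"
      unfolding B_def by (intro continuous_intros cont continuous_on_grad_N cN) auto
  qed
  have lim: "(\<lambda>n. F n x) \<longlonglongrightarrow> f x" for x
  proof (cases "g x = 0")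
    \<comment> \<open>Both sides are 0, since \<open>grad N x = 0\<close> and
      \<open>0 powr p = 0\<close>.\<close>
    case True
    then show ?thesis by (simp add: F_def f_def)
  next
    case False
    have gp: "0 < g x" using False by simp
    have *: "((g x)\<^sup>2) powr ((p - 2) / 2) = g x powr (p - 2)"
    proof -
      have "((g x)\<^sup>2) powr ((p - 2) / 2) = g x powr (2 * ((p - 2) / 2))"
        using gp by (simp only: powr_powr flip: powr_numeral)
      moreover have "2 * ((p - 2) / 2) = p - 2" by simp
      ultimately show ?thesis by (simp only:)
    qed
    have w: "(\<lambda>n. weight p (e n) x) \<longlonglongrightarrow> g x powr (p - 2) * N x powr (1 - p)"
    proof -
      have "(\<lambda>n. ((g x)\<^sup>2 + e n) powr ((p - 2) / 2)) \<longlonglongrightarrow> ((g x)\<^sup>2 + 0) powr ((p - 2) / 2)"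
        by (intro tendsto_intros e0) (use gp in auto)
      then show ?thesis unfolding weight_def using * by (intro tendsto_mult tendsto_const) simp
    qed
    have "f x = g x powr (p - 2) * N x powr (1 - p) * (grad \<psi> x \<bullet> grad N x)
            + (real Q - p) * \<psi> x * (g x powr (p - 2) * N x powr (1 - p) * (g x)\<^sup>2 / N x)"
    proof (cases "x = 0")
      case True
      then show ?thesis using K(2,3) by (auto simp: f_def)
    next
      case False
      then have "g x powr p / N x powr p = g x powr (p - 2) * N x powr (1 - p) * (g x)\<^sup>2 / N x"
        using gp N_pos[OF False] by (simp add: powr_diff)
      then show ?thesis unfolding f_def by (simp only:)
    qed
    moreover have "(\<lambda>n. F n x) \<longlonglongrightarrow> g x powr (p - 2) * N x powr (1 - p) * (grad \<psi> x \<bullet> grad N x)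
            + (real Q - p) * \<psi> x * (g x powr (p - 2) * N x powr (1 - p) * (g x)\<^sup>2 / N x)"
      unfolding F_def divide_inverse by (intro tendsto_intros w)
    ultimately show ?thesis by simp
  qed
  have bound: "norm (F n x) \<le> B x" for n x
  proof -
    \<comment> \<open>As g is at most the square root of s, each factor g raises the exponent by
      1/2. The resulting (p-1)/2 and p/2 are nonnegative, so the powers are monotone in s although p
      - 2 may be negative.\<close>
    define s where "s = (g x)\<^sup>2 + e n"
    have s: "0 < s" "(g x)\<^sup>2 \<le> s" "s \<le> (g x)\<^sup>2 + 1"
      using e[of n] by (auto simp: s_def add_nonneg_pos)
    have "g x \<le> s powr (1 / 2)"
      using s(1,2) real_le_rsqrt[of "g x" s] by (simp add: powr_half_sqrt)
    then have "s powr ((p - 2) / 2) * g x \<le> s powr ((p - 2) / 2) * s powr (1 / 2)"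
      by (intro mult_left_mono) auto
    also have "\<dots> = s powr ((p - 1) / 2)"
      by (simp add: diff_divide_distrib flip: powr_add)
    also have "\<dots> \<le> ((g x)\<^sup>2 + 1) powr ((p - 1) / 2)"
      using s p by (intro powr_mono2) auto
    finally have 1: "s powr ((p - 2) / 2) * g x \<le> ((g x)\<^sup>2 + 1) powr ((p - 1) / 2)" .
    have "s powr ((p - 2) / 2) * (g x)\<^sup>2 \<le> s powr ((p - 2) / 2) * s"
      using s(2) by (intro mult_left_mono) auto
    also have "\<dots> = s powr (p / 2)"
      using s(1) powr_mult_base[of s "(p - 2) / 2"] by (simp add: mult.commute diff_divide_distrib)
    also have "\<dots> \<le> ((g x)\<^sup>2 + 1) powr (p / 2)"
      using s p by (intro powr_mono2) auto
    finally have 2: "s powr ((p - 2) / 2) * (g x)\<^sup>2 \<le> ((g x)\<^sup>2 + 1) powr (p / 2)" .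
    have w: "weight p (e n) x = s powr ((p - 2) / 2) * N x powr (1 - p)"
      by (simp add: weight_def s_def)
    have "\<bar>weight p (e n) x * (grad \<psi> x \<bullet> grad N x)\<bar> \<le> weight p (e n) x * (norm (grad \<psi> x) * g x)"
      unfolding abs_mult using Cauchy_Schwarz_ineq2[of "grad \<psi> x" "grad N x"]
      by (simp add: w mult_left_mono)
    also have "\<dots> = (s powr ((p - 2) / 2) * g x) * N x powr (1 - p) * norm (grad \<psi> x)"
      by (simp add: w mult_ac)
    also have "\<dots> \<le> ((g x)\<^sup>2 + 1) powr ((p - 1) / 2) * N x powr (1 - p) * norm (grad \<psi> x)"
      using 1 by (intro mult_right_mono) auto
    finally have 3: "\<bar>weight p (e n) x * (grad \<psi> x \<bullet> grad N x)\<bar>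
        \<le> ((g x)\<^sup>2 + 1) powr ((p - 1) / 2) * N x powr (1 - p) * norm (grad \<psi> x)" .
    have "\<bar>(real Q - p) * \<psi> x * (weight p (e n) x * (g x)\<^sup>2 / N x)\<bar>
        = \<bar>real Q - p\<bar> * \<bar>\<psi> x\<bar> * ((s powr ((p - 2) / 2) * (g x)\<^sup>2) * N x powr (1 - p) / N x)"
      using N_nonneg[of x] by (simp add: abs_mult w mult_ac)
    also have "\<dots> \<le> \<bar>real Q - p\<bar> * \<bar>\<psi> x\<bar> * (((g x)\<^sup>2 + 1) powr (p / 2) * N x powr (1 - p) / N x)"
      using 2 N_nonneg[of x] by (intro mult_left_mono mult_right_mono divide_right_mono) auto
    finally show ?thesis using 3 unfolding F_def B_def real_norm_def by linarith
  qed
  have meas: "f \<in> borel_measurable lborel"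
    using borel_measurable_LIMSEQ_real[OF lim borel_measurable_integrable[OF Fi]] by simp
  have dct: "integrable lborel f \<and> (\<lambda>n. LINT x|lborel. F n x) \<longlonglongrightarrow> (LINT x|lborel. f x)"
    using integrable_dominated_convergence[OF meas borel_measurable_integrable[OF Fi] Bi AE_I2[OF lim] AE_I2[OF bound]]
      integral_dominated_convergence[OF meas borel_measurable_integrable[OF Fi] Bi AE_I2[OF lim] AE_I2[OF bound]]
    by blast
  then show "integrable lborel f" by blast
  have "(LINT x|lborel. F n x) = 0" for n
    unfolding F_def by (rule regularized_identity[OF e(1) \<psi> K])
  with dct show "(LINT x|lborel. f x) = 0" by (simp add: LIMSEQ_const_iff)
qed

lemma continuous_on_hardy_weight:
  assumes "0 < p"
  shows "continuous_on (- {0}) (\<lambda>x. g x powr p / N x powr p)"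
  using assms
  by (intro continuous_on_divide continuous_on_powr' continuous_intros continuous_on_grad_N continuous_on_N_powr)
     auto

text \<open>For psi = |phi|^p, Cauchy-Schwarz and \<open>young_powr\<close> bound the gradient term
  of \<open>weighted_identity\<close> below by -(p-1) c A - c^(1-p) B. The other term is c p A,
  because c p = Q - p, so c A - c^(1-p) B lies below an integrand with integral 0.\<close>

theorem hardy:
  assumes p: "1 < p" "p < real Q" and \<phi>: "test_function (- {0}) \<phi>"
  shows "((real Q - p) / p) powr p * (LINT x|lborel. g x powr p / N x powr p * \<bar>\<phi> x\<bar> powr p)
      \<le> (LINT x|lborel. norm (grad \<phi> x) powr p)"
proof -
  define c where "c = (real Q - p) / p"
  have c: "0 < c" using p by (simp add: c_def)
  have cp: "c * p = real Q - p" using p by (simp add: c_def)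
  define K where "K = closure {x. \<phi> x \<noteq> 0}"
  have K: "compact K" "K \<subseteq> - {0}" "\<And>x. x \<notin> K \<Longrightarrow> \<phi> x = 0"
    using \<phi> closure_subset[of "{x. \<phi> x \<noteq> 0}"] by (auto simp: test_function_def K_def)
  have sm: "Ck_on l T \<phi>" for l T
    using \<phi> Ck_on_subset[OF _ subset_UNIV] by (auto simp: test_function_def smooth_on_def)
  note cl = compact_imp_closed[OF K(1)]
  define A where "A x = g x powr p / N x powr p * \<bar>\<phi> x\<bar> powr p" for x
  define B where "B x = norm (grad \<phi> x) powr p" for x
  define \<psi> where "\<psi> x = \<bar>\<phi> x\<bar> powr p" for x
  have C\<psi>: "Ck_on (Suc 0) (- {0}) \<psi>"
    unfolding \<psi>_def
  proof (rule Ck_on_compose[OF open_punctured UNIV_I sm])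
    \<comment> \<open>One order of differentiability is what \<open>weighted_identity\<close> asks
      of its test function.\<close>
    show "Ck_on (Suc 0) UNIV (\<lambda>t. \<bar>t\<bar> powr p)"
    proof (rule Ck_on_real_SucI[OF open_UNIV abs_powr_derivative(1)[OF p(1)]])
      show "Ck_on 0 UNIV (\<lambda>t. p * (sgn t * \<bar>t\<bar> powr (p - 1)))"
        using abs_powr_derivative(2)[OF p(1)] continuous_on_mult_left by simp
    qed
  qed
  have \<psi>0: "\<psi> x = 0" if "x \<notin> K" for x using K(3)[OF that] by (simp add: \<psi>_def)
  have cont: "continuous_on (- {0}) \<phi>" "continuous_on (- {0}) (grad \<phi>)"
    using Ck_on_imp_continuous_on[OF sm] continuous_on_grad[OF open_punctured sm] by auto
  have Ai: "integrable lborel A"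
  proof (rule integrable_punctured[OF K(1,2)])
    show "continuous_on (- {0}) A"
      unfolding A_def using p
      by (intro continuous_on_mult continuous_on_hardy_weight continuous_on_powr' continuous_intros cont) auto
  qed (simp add: A_def K(3))
  have Bi: "integrable lborel B"
  proof (rule integrable_punctured[OF K(1,2)])
    show "B x = 0" if "x \<notin> K" for x
      using grad_zero_outside[OF cl K(3) that] p by (simp add: B_def)
    show "continuous_on (- {0}) B"
      unfolding B_def using p by (intro continuous_on_powr' continuous_intros cont) auto
  qed
  let ?f = "\<lambda>x. g x powr (p - 2) * N x powr (1 - p) * (grad \<psi> x \<bullet> grad N x)
            + (real Q - p) * \<psi> x * (g x powr p / N x powr p)"
  have f: "integrable lborel ?f" "(LINT x|lborel. ?f x) = 0"
    using weighted_identity[OF p(1) C\<psi> K(1,2) \<psi>0] by auto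
  have pointwise: "c * A x - c powr (1 - p) * B x \<le> ?f x" for x
  \<comment> \<open>In the degenerate case \<open>A x\<close> and \<open>?f x\<close> vanish, while
    \<open>B x\<close> is nonnegative.\<close>
  proof (cases "x = 0 \<or> g x = 0")
    case True
    then show ?thesis
    proof
      assume "x = 0"
      then have "x \<notin> K" using K(2) by auto
      then show ?thesis
        using K(3) grad_zero_outside[OF cl K(3) \<open>x \<notin> K\<close>] grad_zero_outside[OF cl \<psi>0 \<open>x \<notin> K\<close>] p
        by (simp add: A_def B_def \<psi>0)
    qed (simp add: A_def B_def)
  next
    case False
    then have x: "x \<noteq> 0" and gp: "0 < g x" and Np: "0 < N x" using N_pos by auto
    \<comment> \<open>Chosen so that \<open>a powr p\<close> is \<open>A x\<close>,
      \<open>b powr p\<close> is \<open>B x\<close>, and p a^(p-1) b is the bound on the gradient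
      term.\<close>
    define a where "a = g x / N x * \<bar>\<phi> x\<bar>"
    define b where "b = norm (grad \<phi> x)"
    have ap: "a powr p = A x"
      using gp Np by (simp add: a_def A_def powr_mult powr_divide)
    have gr: "grad \<psi> x = (p * (sgn (\<phi> x) * \<bar>\<phi> x\<bar> powr (p - 1))) *\<^sub>R grad \<phi> x"
      unfolding \<psi>_def
      by (rule grad_compose[OF _ abs_powr_derivative(1)[OF p(1)]]) (use sm[of "Suc 0" UNIV] in simp)
    have "\<bar>grad \<psi> x \<bullet> grad N x\<bar> \<le> norm (grad \<psi> x) * g x"
      by (rule Cauchy_Schwarz_ineq2)
    also have "\<dots> \<le> p * \<bar>\<phi> x\<bar> powr (p - 1) * b * g x"
      unfolding gr b_def norm_scaleR using p
      by (intro mult_right_mono) (auto simp: abs_mult sgn_if)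
    finally have "g x powr (p - 2) * N x powr (1 - p) * \<bar>grad \<psi> x \<bullet> grad N x\<bar>
        \<le> g x powr (p - 2) * N x powr (1 - p) * (p * \<bar>\<phi> x\<bar> powr (p - 1) * b * g x)"
      by (intro mult_left_mono) auto
    also have "\<dots> = p * a powr (p - 1) * b"
    proof -
      have "a powr (p - 1) = g x powr (p - 2) * g x * N x powr (1 - p) * \<bar>\<phi> x\<bar> powr (p - 1)"
        using gp Np by (simp add: a_def powr_mult powr_divide powr_diff power2_eq_square field_simps)
      then show ?thesis by (simp add: mult_ac)
    qed
    also have "\<dots> \<le> (p - 1) * c * a powr p + c powr (1 - p) * b powr p"
      by (rule young_powr[OF p(1) c]) (use gp Np in \<open>auto simp: a_def b_def\<close>)
    finally have "- (g x powr (p - 2) * N x powr (1 - p) * (grad \<psi> x \<bullet> grad N x))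
        \<le> (p - 1) * c * A x + c powr (1 - p) * B x"
      unfolding ap by (simp add: B_def b_def) (smt (verit) mult_minus_right mult_left_mono abs_ge_minus_self mult_nonneg_nonneg powr_ge_zero)
    moreover have "(real Q - p) * \<psi> x * (g x powr p / N x powr p) = c * p * A x"
      unfolding cp by (simp add: A_def \<psi>_def mult_ac)
    ultimately show ?thesis by (simp add: algebra_simps)
  qed
  have "(LINT x|lborel. c * A x - c powr (1 - p) * B x) \<le> (LINT x|lborel. ?f x)"
    by (rule integral_mono) (use Ai Bi f pointwise in auto)
  then have "c * (LINT x|lborel. A x) \<le> c powr (1 - p) * (LINT x|lborel. B x)"
    using Ai Bi f(2) by simp
  then have "c powr (p - 1) * (c * (LINT x|lborel. A x))
      \<le> c powr (p - 1) * (c powr (1 - p) * (LINT x|lborel. B x))"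
    by (intro mult_left_mono) auto
  moreover have "c powr (p - 1) * c = c powr p" "c powr (p - 1) * c powr (1 - p) = 1"
    using c by (simp_all add: powr_diff)
  ultimately have "c powr p * (LINT x|lborel. A x) \<le> (LINT x|lborel. B x)"
    by (metis mult.assoc mult_1)
  then show ?thesis unfolding c_def A_def B_def .
qed

end

section \<open>Sharpness\<close>

lemma flat_nonneg: "(\<And>x. 0 < x \<Longrightarrow> 0 \<le> poly P x) \<Longrightarrow> 0 \<le> flat P t"
  by (simp add: flat_def)

text \<open>The quotient is written with \<open>powr (-1)\<close> so that smoothness follows from
  \<open>Ck_on_powr\<close>.\<close>

definition step :: "real \<Rightarrow> real" where
  "step t = flat 1 t * (flat 1 t + flat 1 (1 - t)) powr (-1)"

text \<open>The quotient rule applied to \<open>step\<close>, where \<open>flat (monom 1 2)\<close>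
  is the derivative of \<open>flat 1\<close>.\<close>

definition bump :: "real \<Rightarrow> real" where
  "bump t = (flat (monom 1 2) t * flat 1 (1 - t) + flat 1 t * flat (monom 1 2) (1 - t))
    / (flat 1 t + flat 1 (1 - t))\<^sup>2"

lemma flat_denominator_pos: "0 < flat 1 t + flat 1 (1 - t)"
  by (cases "t \<le> 0") (auto simp: flat_def add_pos_nonneg)

lemma step_derivative: "(step has_real_derivative bump t) (at t)"
proof -
  let ?D = "\<lambda>t. flat 1 t + flat 1 (1 - t)"
  have f: "(flat 1 has_real_derivative flat (monom 1 2) t) (at t)" for t
    using flat_derivative[of 1 t] by (simp add: one_pCons[symmetric] pderiv_1)
  have f1: "((\<lambda>t. flat 1 (1 - t)) has_real_derivative flat (monom 1 2) (1 - t) * (- 1)) (at t)"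
    by (rule DERIV_chain2[OF f]) (auto intro!: derivative_eq_intros)
  have "((\<lambda>t. flat 1 t / ?D t) has_real_derivative bump t) (at t)"
    using DERIV_divide[OF f DERIV_add[OF f f1]] flat_denominator_pos[of t]
    by (simp add: bump_def algebra_simps power2_eq_square)
  moreover have "(\<lambda>t. flat 1 t / ?D t) = step"
    using flat_denominator_pos by (auto simp: step_def fun_eq_iff powr_minus_divide less_imp_le)
  ultimately show ?thesis by simp
qed

lemma Ck_on_step: "Ck_on k UNIV (\<lambda>s. step (s + a))"
proof -
  have lin: "Ck_on k UNIV (\<lambda>s::real. s + a)"
    by (intro Ck_on_add Ck_on_const Ck_on_bounded_linear bounded_linear_ident open_UNIV)
  have "Ck_on k UNIV (\<lambda>s::real. 1 - s)"
    by (intro Ck_on_diff Ck_on_const Ck_on_bounded_linear bounded_linear_ident open_UNIV)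
  then have "Ck_on k UNIV (\<lambda>s. flat 1 (1 - s))"
    by (rule Ck_on_compose[OF open_UNIV UNIV_I _ Ck_on_flat])
  then have "Ck_on k UNIV (\<lambda>s. flat 1 s + flat 1 (1 - s))"
    by (rule Ck_on_add[OF open_UNIV Ck_on_flat])
  then have "Ck_on k UNIV (\<lambda>s. (flat 1 s + flat 1 (1 - s)) powr (-1))"
    by (rule Ck_on_compose[OF open_UNIV _ _ Ck_on_powr, rotated]) (simp add: flat_denominator_pos)
  then have "Ck_on k UNIV step"
    unfolding step_def[abs_def] by (rule Ck_on_mult[OF open_UNIV Ck_on_flat])
  then show ?thesis
    by (rule Ck_on_compose[OF open_UNIV UNIV_I lin])
qed

lemma step_0: "t \<le> 0 \<Longrightarrow> step t = 0"
  by (simp add: step_def flat_def)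

lemma step_1: "1 \<le> t \<Longrightarrow> step t = 1"
  by (simp add: step_def flat_def powr_minus)

lemma bump_nonneg: "0 \<le> bump t"
  unfolding bump_def
  by (intro divide_nonneg_nonneg add_nonneg_nonneg mult_nonneg_nonneg flat_nonneg) (auto simp: poly_monom)

lemma bump_0: "t \<le> 0 \<or> 1 \<le> t \<Longrightarrow> bump t = 0"
  by (auto simp: bump_def flat_def)

lemma step_mono: "s \<le> t \<Longrightarrow> step s \<le> step t"
  by (rule DERIV_nonneg_imp_nondecreasing) (use step_derivative bump_nonneg in blast)+

lemma step_range: "0 \<le> step t" "step t \<le> 1"
  using step_mono[of "min t 0" t] step_mono[of t "max t 1"] by (auto simp: step_0 step_1)

lemma continuous_on_bump: "continuous_on S bump"
proof -
  have c: "continuous_on UNIV (flat P)" for P using Ck_on_flat[of 0] by simp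
  have c1: "continuous_on UNIV (\<lambda>t. flat P (1 - t))" for P
    by (rule continuous_on_compose2[OF c]) (auto intro!: continuous_intros)
  have "continuous_on UNIV bump"
    unfolding bump_def[abs_def] using flat_denominator_pos
    by (intro continuous_intros c c1) (auto simp: less_imp_neq[symmetric])
  then show ?thesis using continuous_on_subset by blast
qed

lemma bump_positive: obtains z where "0 < bump z"
proof -
  obtain z where "step 1 - step 0 = (1 - 0) * bump z"
    using MVT2[of 0 1 step bump] step_derivative by auto
  then show ?thesis by (intro that[of z]) (simp add: step_0 step_1)
qed

lemma bump_bounded: obtains B where "0 < B" "\<And>t. bump t \<le> B"
proof -
  have "compact (bump ` {0..1})"
    by (intro compact_continuous_image continuous_on_bump compact_Icc)
  then obtain B where B: "\<And>t. t \<in> {0..1} \<Longrightarrow> \<bar>bump t\<bar> \<le> B"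
    using compact_imp_bounded bounded_iff by (metis imageI real_norm_def)
  have "bump t \<le> max B 1" for t
    using B[of t] bump_0[of t] by (cases "t \<in> {0..1}") (auto simp: not_le)
  then show ?thesis by (intro that[of "max B 1"]) auto
qed

text \<open>Each \<open>bump\<close> vanishes outside the open unit interval, so at most one of its
  integer translates is nonzero at a given point.\<close>

lemma sum_bump_le:
  assumes "\<And>t. bump t \<le> B" "0 < B"
  shows "(\<Sum>j<n. bump (s - real j)) \<le> B"
proof (cases "\<forall>j<n. bump (s - real j) = 0")
  case False
  then obtain i where i: "i < n" "bump (s - real i) \<noteq> 0" by auto
  have "bump (s - real j) = 0" if "j \<noteq> i" for j
    using bump_0[of "s - real i"] bump_0[of "s - real j"] i(2) that by linarith
  then have "(\<Sum>j<n. bump (s - real j)) = bump (s - real i)"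
    using i(1) by (subst sum.remove[of _ i]) auto
  then show ?thesis using assms(1) by simp
qed (use assms in auto)

text \<open>On [-R, R] the derivative is at most p R^(p-1) in absolute value. This controls the
  error made by dropping the derivative of the plateau.\<close>

lemma abs_powr_lipschitz:
  fixes x y p R :: real
  assumes "1 < p" "\<bar>x\<bar> \<le> R" "\<bar>y\<bar> \<le> R"
  shows "\<bar>x\<bar> powr p \<le> \<bar>y\<bar> powr p + p * R powr (p - 1) * \<bar>x - y\<bar>"
proof -
  have "norm (\<bar>x\<bar> powr p - \<bar>y\<bar> powr p) \<le> p * R powr (p - 1) * norm (x - y)"
  proof (rule field_differentiable_bound[where S = "{-R..R}"])
    show "((\<lambda>t. \<bar>t\<bar> powr p) has_field_derivative p * (sgn t * \<bar>t\<bar> powr (p - 1))) (at t within {-R..R})" for t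
      using abs_powr_derivative(1)[OF assms(1)] by (rule has_field_derivative_at_within)
    show "norm (p * (sgn t * \<bar>t\<bar> powr (p - 1))) \<le> p * R powr (p - 1)" if "t \<in> {-R..R}" for t
      using that assms(1) by (auto simp: abs_mult sgn_if intro!: powr_mono2)
  qed (use assms in auto)
  then show ?thesis by auto
qed

section \<open>A point where the horizontal gradient of N does not vanish\<close>

context carnot_group
begin

text \<open>Along the segment from x to y only coordinates of weight at least
  \<open>\<alpha> j\<close> change, and by \<open>hfield_partial_zero\<close> the coefficient has
  zero derivative in those directions.\<close>

lemma hfield_triangular:
  assumes i: "\<alpha> i = 1" and eq: "\<And>l. \<alpha> l < \<alpha> j \<Longrightarrow> x $ l = y $ l"
  shows "hfield gmul i x $ j = hfield gmul i y $ j"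
proof -
  let ?c = "\<lambda>x. hfield gmul i x $ j"
  have "Ck_on (Suc 0) UNIV ?c" by (rule Ck_on_component[OF open_UNIV Ck_on_hfield])
  then have d: "?c differentiable (at z)" for z by simp
  have zero: "frechet_derivative ?c (at z) (y - x) = 0" for z
    unfolding frechet_derivative_components[OF d, of z "y - x"]
    using eq hfield_partial_zero[OF i, of j] by (intro sum.neutral) (metis diff_self mult_zero_left mult_zero_right not_le vector_minus_component)
  have "((\<lambda>s. ?c (x + s *\<^sub>R (y - x))) has_real_derivative 0) (at s)" for s
  proof -
    have "((\<lambda>s. ?c (x + s *\<^sub>R (y - x))) has_derivative
        (\<lambda>h. frechet_derivative ?c (at (x + s *\<^sub>R (y - x))) (h *\<^sub>R (y - x)))) (at s)"
      by (rule has_derivative_compose[of "\<lambda>s. x + s *\<^sub>R (y - x)" _ s UNIV ?c])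
         (use d in \<open>auto intro!: derivative_eq_intros simp: frechet_derivative_works\<close>)
    moreover have "(\<lambda>h. frechet_derivative ?c (at (x + s *\<^sub>R (y - x))) (h *\<^sub>R (y - x))) = (*) 0"
      using linear_cmul[OF linear_frechet_derivative[OF d]] zero by (simp add: fun_eq_iff)
    ultimately show ?thesis
      by (simp only: has_field_derivative_def)
  qed
  then have "?c (x + 0 *\<^sub>R (y - x)) = ?c (x + 1 *\<^sub>R (y - x))"
    using DERIV_isconst_all by blast
  then show ?thesis by simp
qed

text \<open>The point at time one on the integral curve of \<open>X\<^sub>i\<close> through the origin; by
  triangularity it is a fixed point reached after finitely many iterations.\<close>

lemma hfield_radial_point:
  assumes i: "\<alpha> i = 1"
  obtains y where "y \<noteq> 0" "\<And>j. hfield gmul i y $ j = real (\<alpha> j) * y $ j"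
proof -
  \<comment> \<open>A fixed point of \<open>T\<close> solves the required equation. By triangularity
    the coordinates of weight at most n are settled after n iterations.\<close>
  define T where "T y = (\<chi> j. hfield gmul i y $ j / real (\<alpha> j))" for y
  define Y where "Y n = (T ^^ n) 0" for n
  have Y_Suc: "Y (Suc n) $ j = hfield gmul i (Y n) $ j / real (\<alpha> j)" for n j
    by (simp add: Y_def T_def)
  have stable: "\<forall>j. \<alpha> j \<le> n \<longrightarrow> Y (Suc n) $ j = Y n $ j" for n
  proof (induction n)
    case 0
    then show ?case using weight_pos by (metis not_one_le_zero le_zero_eq)
  next
    case (Suc n)
    show ?case
    proof (intro allI impI)
      fix j assume "\<alpha> j \<le> Suc n"
      then have "hfield gmul i (Y (Suc n)) $ j = hfield gmul i (Y n) $ j"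
        using Suc by (intro hfield_triangular[OF i]) auto
      then show "Y (Suc (Suc n)) $ j = Y (Suc n) $ j"
        unfolding Y_Suc by simp
    qed
  qed
  define M where "M = Max (range \<alpha>)"
  have M: "\<alpha> j \<le> M" for j by (simp add: M_def)
  have fixpoint: "hfield gmul i (Y M) $ j = real (\<alpha> j) * Y M $ j" for j
    using stable[of M] M[of j] weight_pos[of j] Y_Suc[of M j] by (auto simp: field_simps)
  \<comment> \<open>There are no coordinates of weight below 1, so this coefficient has its value at
    the origin, namely 1; this makes the point nonzero.\<close>
  have "hfield gmul i (Y M) $ i = hfield gmul i 0 $ i"
    using i weight_pos by (intro hfield_triangular[OF i]) (metis not_one_le_zero less_one)
  then have "Y M $ i = 1" using fixpoint[of i] by (simp add: hfield_0 i)
  then have "Y M \<noteq> 0" by (metis zero_index zero_neq_one)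
  then show ?thesis using fixpoint by (rule that)
qed

text \<open>The generator of the dilations, the analogue of the Euler field, evaluated at y.\<close>

lemma dilation_derivative:
  "((\<lambda>r. dilation \<alpha> r y) has_derivative (\<lambda>h. h *\<^sub>R (\<chi> j. real (\<alpha> j) * y $ j))) (at 1)"
proof -
  have eq: "v = (\<Sum>j\<in>UNIV. (v $ j) *\<^sub>R axis j 1)" for v :: "real^'n"
    using basis_expansion[of v] by (simp add: scalar_mult_eq_scaleR)
  have "((\<lambda>r. \<Sum>j\<in>UNIV. (r ^ \<alpha> j * y $ j) *\<^sub>R axis j (1::real)) has_derivative
      (\<lambda>h. \<Sum>j\<in>UNIV. (h * (real (\<alpha> j) * y $ j)) *\<^sub>R axis j 1)) (at 1)"
    by (auto intro!: derivative_eq_intros simp: mult_ac)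
  moreover have "(\<Sum>j\<in>UNIV. (r ^ \<alpha> j * y $ j) *\<^sub>R axis j (1::real)) = dilation \<alpha> r y" for r
    using eq[of "dilation \<alpha> r y"] by simp
  moreover have "(\<Sum>j\<in>UNIV. (h * (real (\<alpha> j) * y $ j)) *\<^sub>R axis j (1::real))
      = h *\<^sub>R (\<chi> j. real (\<alpha> j) * y $ j)" for h
    using eq[of "h *\<^sub>R (\<chi> j. real (\<alpha> j) * y $ j)"] by simp
  ultimately show ?thesis by simp
qed

end

context polarizable_carnot
begin

text \<open>Otherwise the sub-Laplacian would be identically 0, which contradicts the defining
  equation of \<open>u\<close> for a test function positive at 0.\<close>

lemma horizontal_exists: obtains i where "\<alpha> i = 1"
proof -
  obtain \<phi> where \<phi>: "test_function (UNIV :: (real^'n) set) \<phi>" "0 < \<phi> 0"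
    using exists_bump[of UNIV 0] by auto
  have "H \<noteq> {}"
  proof
    assume "H = {}"
    then have "laplacian \<phi> x = 0" for x unfolding sub_laplacian_def by (simp only: sum.empty)
    moreover have "- (LINT x|lborel. u x * laplacian \<phi> x) = \<phi> 0"
      using folland \<phi>(1) by (simp add: folland_solution_def fundamental_solution_def)
    ultimately show False using \<phi>(2) by simp
  qed
  then show ?thesis using that by auto
qed

text \<open>At the radial point X_i agrees with the generator of the dilations, so homogeneity gives
  Euler's identity X_i N = N, which is nonzero there.\<close>

lemma grad_N_nonzero: obtains y where "y \<noteq> 0" "0 < g y"
proof -
  obtain i where i: "\<alpha> i = 1" by (rule horizontal_exists)
  obtain y where y: "y \<noteq> 0" "\<And>j. hfield gmul i y $ j = real (\<alpha> j) * y $ j"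
    using hfield_radial_point[OF i] by blast
  have hf: "(\<chi> j. real (\<alpha> j) * y $ j) = hfield gmul i y"
    by (simp add: vec_eq_iff y(2))
  have d1: "dilation \<alpha> 1 y = y" by (simp add: vec_eq_iff)
  have "(N has_derivative frechet_derivative N (at y)) (at (dilation \<alpha> 1 y))"
    using N_differentiable[OF y(1)] by (simp add: d1 frechet_derivative_works)
  from has_derivative_compose[OF dilation_derivative this]
  have "((\<lambda>r. N (dilation \<alpha> r y)) has_derivative
      (\<lambda>h. frechet_derivative N (at y) (h *\<^sub>R hfield gmul i y))) (at 1)"
    unfolding hf .
  then have "((\<lambda>r. r * N y) has_derivative
      (\<lambda>h. frechet_derivative N (at y) (h *\<^sub>R hfield gmul i y))) (at 1)"
    by (rule has_derivative_transform_within_open[where s = "{0<..}"]) (auto simp: N_dilation)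
  moreover have "((\<lambda>r. r * N y) has_derivative (\<lambda>h. h * N y)) (at 1)"
    by (auto intro!: derivative_eq_intros)
  ultimately have "(\<lambda>h. frechet_derivative N (at y) (h *\<^sub>R hfield gmul i y)) = (\<lambda>h. h * N y)"
    by (rule has_derivative_unique)
  from fun_cong[OF this, of 1] have "X i N y = N y" by (simp add: vf_apply_def)
  then have "grad N y $ i \<noteq> 0" using y(1) i by (simp add: hgrad_def)
  then have "0 < g y" by auto
  then show ?thesis using y(1) that by blast
qed

text \<open>On the Euclidean unit sphere N has a minimum m > 0. A point outside the unit ball is
  dilated back to the sphere by some r in (0, 1]; then m is at most r R, and r^M |x| at most 1 for
  the largest weight M.\<close>

lemma N_sublevel_bounded: "bounded {x. N x \<le> R}"
proof -
  have "sphere 0 1 \<noteq> ({} :: (real^'n) set)" by simp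
  moreover have "continuous_on (sphere 0 1) N" using N_continuous continuous_on_subset by blast
  ultimately obtain z where z: "z \<in> sphere 0 1" "\<And>x. x \<in> sphere 0 1 \<Longrightarrow> N z \<le> N x"
    using continuous_attains_inf[OF compact_sphere] by metis
  define m where "m = N z"
  have m: "0 < m" unfolding m_def using z(1) by (intro N_pos) auto
  define M where "M = Max (range \<alpha>)"
  have M: "\<alpha> j \<le> M" for j by (simp add: M_def)
  have "norm x \<le> max 1 (1 / (m / R) ^ M)" if "N x \<le> R" for x
  proof (cases "norm x \<le> 1")
    case False
    have cont: "continuous_on {0..1} (\<lambda>r. norm (dilation \<alpha> r x))"
      unfolding dilation_def by (intro continuous_intros continuous_on_vec_lambda)
    have d0: "dilation \<alpha> 0 x = 0"
    proof -
      have "(0::real) ^ \<alpha> i = 0" for i using weight_pos[of i] by (simp add: power_0_left)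
      then show ?thesis by (simp add: vec_eq_iff)
    qed
    have d1: "dilation \<alpha> 1 x = x" by (simp add: vec_eq_iff)
    \<comment> \<open>The norm moves continuously from 0 at r = 0 to a value above 1 at r =
      1.\<close>
    obtain r where r: "0 \<le> r" "r \<le> 1" "norm (dilation \<alpha> r x) = 1"
      using IVT'[of "\<lambda>r. norm (dilation \<alpha> r x)" 0 1 1] cont False d0 d1 by auto
    then have "r \<noteq> 0" using d0 by auto
    then have rp: "0 < r" using r by simp
    have "m \<le> N (dilation \<alpha> r x)" unfolding m_def using r(3) by (intro z(2)) simp
    also have "\<dots> \<le> r * R" using that rp by (simp add: N_dilation)
    finally have mr: "m \<le> r * R" .
    then have R: "0 < R" using m rp by (smt (verit) mult_nonneg_nonpos)
    have "norm (r ^ M *\<^sub>R x) \<le> norm (dilation \<alpha> r x)"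
    proof (rule norm_le_componentwise_cart)
      fix j
      have "r ^ M \<le> r ^ \<alpha> j" using M r by (intro power_decreasing) auto
      then show "norm ((r ^ M *\<^sub>R x) $ j) \<le> norm (dilation \<alpha> r x $ j)"
        using rp by (simp add: abs_mult mult_right_mono)
    qed
    then have "r ^ M * norm x \<le> 1" using r rp by simp
    moreover have "(m / R) ^ M \<le> r ^ M"
      using mr R m by (intro power_mono) (auto simp: field_simps)
    ultimately have "(m / R) ^ M * norm x \<le> 1"
      by (meson mult_right_mono norm_ge_zero order_trans)
    then have "norm x \<le> 1 / (m / R) ^ M" using m R by (simp add: field_simps)
    then show ?thesis by simp
  qed simp
  then show ?thesis unfolding bounded_iff by blast
qed

section \<open>Compact shells and the functional \<open>\<Lambda>\<close>\<close>

definition shell :: "real \<Rightarrow> (real^'n) set" where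
  "shell L = {x. exp (- L) \<le> N x \<and> N x \<le> exp L}"

lemma shell: "compact (shell L)" "shell L \<subseteq> - {0}"
  and shell_outside: "x \<noteq> 0 \<Longrightarrow> x \<notin> shell L \<Longrightarrow> ln (N x) \<notin> {- L..L}"
proof -
  have "closed (shell L)"
    unfolding shell_def using N_continuous
    by (intro closed_Collect_conj closed_Collect_le continuous_intros)
  moreover have "bounded (shell L)"
    by (rule bounded_subset[OF N_sublevel_bounded[of "exp L"]]) (auto simp: shell_def)
  ultimately show "compact (shell L)" by (simp add: compact_eq_bounded_closed)
  show "shell L \<subseteq> - {0}"
    using N_0 by (auto simp: shell_def)
  show "ln (N x) \<notin> {- L..L}" if "x \<noteq> 0" "x \<notin> shell L"
  proof -
    have "exp (ln (N x)) = N x" using N_pos[OF that(1)] by simp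
    then have "- L \<le> ln (N x) \<and> ln (N x) \<le> L \<longleftrightarrow> exp (- L) \<le> N x \<and> N x \<le> exp L"
      by (metis exp_le_cancel_iff)
    then show ?thesis using that(2) by (simp add: shell_def)
  qed
qed

text \<open>At the origin the value is 0 because \<open>0 powr a = 0\<close>, so no case distinction
  is needed there.\<close>

definition radial :: "real \<Rightarrow> (real \<Rightarrow> real) \<Rightarrow> real^'n \<Rightarrow> real" where
  "radial p h x = g x powr p * N x powr (- real Q) * h (ln (N x))"

lemma radial_zero: "(\<And>t. t \<notin> {- L..L} \<Longrightarrow> h t = 0) \<Longrightarrow> x \<notin> shell L \<Longrightarrow> radial p h x = 0"
  using shell_outside[of x L] by (cases "x = 0") (auto simp: radial_def)

lemma continuous_on_radial:
  assumes "0 < p" "continuous_on UNIV h"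
  shows "continuous_on (- {0}) (radial p h)"
proof -
  have "continuous_on (- {0}) (\<lambda>x. h (ln (N x)))"
    by (rule continuous_on_compose2[OF assms(2)])
       (use Ck_on_N[of 0] in \<open>auto intro!: continuous_intros\<close>)
  then show ?thesis
    unfolding radial_def[abs_def] using assms(1)
    by (intro continuous_on_mult continuous_on_powr' continuous_intros continuous_on_grad_N continuous_on_N_powr) auto
qed

lemma integrable_radial:
  assumes "0 < p" "continuous_on UNIV h" "\<And>t. t \<notin> {- L..L} \<Longrightarrow> h t = 0"
  shows "integrable lborel (radial p h)"
  by (rule integrable_punctured[OF shell radial_zero[OF assms(3)] continuous_on_radial[OF assms(1,2)]])

definition \<Lambda> :: "real \<Rightarrow> (real \<Rightarrow> real) \<Rightarrow> real" where
  "\<Lambda> p h = (LINT x|lborel. radial p h x)"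

text \<open>\<open>weighted_identity\<close> for N^(p-Q) h(ln N). Differentiating the power produces
  the factor p - Q, which cancels the zero-order term and leaves only h'.\<close>

lemma \<Lambda>_derivative:
  assumes p: "1 < p" and der: "\<And>t. (h has_real_derivative h' t) (at t)"
    and cont: "continuous_on UNIV h'" and supp: "\<And>t. t \<notin> {- L..L} \<Longrightarrow> h t = 0"
  shows "\<Lambda> p h' = 0"
proof -
  let ?G = "\<lambda>r. r powr (p - real Q) * h (ln r)"
  let ?\<psi> = "\<lambda>x. ?G (N x)"
  have lnN: "Ck_on l (- {0}) (\<lambda>x. ln (N x))" for l
    by (rule Ck_on_compose[OF open_punctured _ Ck_on_N Ck_on_ln]) (simp add: N_pos)
  have "Ck_on (Suc 0) UNIV h"
    by (rule Ck_on_real_SucI[OF open_UNIV der]) (use cont in simp)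
  then have C: "Ck_on (Suc 0) (- {0}) ?\<psi>"
    by (intro Ck_on_mult[OF open_punctured Ck_on_N_powr] Ck_on_compose[OF open_punctured UNIV_I lnN])
  have \<psi>0: "?\<psi> x = 0" if "x \<notin> shell L" for x
    using shell_outside[OF _ that] supp by (cases "x = 0") auto
  have "g x powr (p - 2) * N x powr (1 - p) * (grad ?\<psi> x \<bullet> grad N x)
            + (real Q - p) * ?\<psi> x * (g x powr p / N x powr p) = radial p h' x" for x
  proof (cases "x = 0 \<or> g x = 0")
    case True
    then show ?thesis
    proof
      assume "x = 0"
      then have "x \<notin> shell L" using shell(2) by auto
      from grad_zero_outside[OF compact_imp_closed[OF shell(1)] \<psi>0 this]
      show ?thesis using \<open>x = 0\<close> by (simp add: radial_def)
    qed (simp add: radial_def)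
  next
    case False
    then have x: "x \<noteq> 0" and gp: "0 < g x" and Np: "0 < N x" using N_pos by auto
    let ?n = "N x" and ?s = "ln (N x)"
    have "(?G has_real_derivative ((p - real Q) * ?n powr (p - real Q - 1) * h ?s
        + h' ?s * (1 / ?n) * ?n powr (p - real Q))) (at ?n)"
      by (rule DERIV_mult[OF has_real_derivative_powr[OF Np] DERIV_chain2[OF der DERIV_ln_divide[OF Np]]])
    from grad_compose[OF N_differentiable[OF x] this]
    have inner: "grad ?\<psi> x \<bullet> grad N x = ((p - real Q) * ?n powr (p - real Q - 1) * h ?s
        + h' ?s * (1 / ?n) * ?n powr (p - real Q)) * (g x)\<^sup>2"
      by (simp add: power2_norm_eq_inner)
    have e1: "g x powr (p - 2) * (g x)\<^sup>2 = g x powr p"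
      using gp by (simp add: powr_diff)
    have e2: "?n powr (1 - p) * ?n powr (p - real Q - 1) = ?n powr (- real Q)"
      by (simp flip: powr_add)
    have e3: "?n powr (1 - p) * ((1 / ?n) * ?n powr (p - real Q)) = ?n powr (- real Q)"
    proof -
      have "(1 / ?n) * ?n powr (p - real Q) = ?n powr (p - real Q - 1)"
        using Np by (simp add: powr_diff)
      then show ?thesis by (simp flip: powr_add)
    qed
    have e4: "?n powr (p - real Q) / ?n powr p = ?n powr (- real Q)"
      by (simp flip: powr_diff)
    have "g x powr (p - 2) * ?n powr (1 - p) * (grad ?\<psi> x \<bullet> grad N x)
        = (g x powr (p - 2) * (g x)\<^sup>2) * ((p - real Q) * h ?s * (?n powr (1 - p) * ?n powr (p - real Q - 1))
          + h' ?s * (?n powr (1 - p) * ((1 / ?n) * ?n powr (p - real Q))))"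
      unfolding inner by (simp only: distrib_left distrib_right mult_ac)
    moreover have "(real Q - p) * ?\<psi> x * (g x powr p / ?n powr p)
        = (real Q - p) * (g x powr p * (h ?s * (?n powr (p - real Q) / ?n powr p)))"
      by (simp only: mult_ac times_divide_eq_right)
    ultimately show ?thesis unfolding e1 e2 e3 e4 radial_def by (simp only: algebra_simps)
  qed
  then show ?thesis
    unfolding \<Lambda>_def using weighted_identity(2)[OF p C shell \<psi>0] by simp
qed

lemma bump_shift_support: "t \<notin> {- (\<bar>a\<bar> + 1)..\<bar>a\<bar> + 1} \<Longrightarrow> bump (t + a) = 0"
  by (rule bump_0) auto

lemma continuous_on_bump_shift: "continuous_on UNIV (\<lambda>t. bump (t + a))"
  by (rule continuous_on_compose2[OF continuous_on_bump[of UNIV]]) (auto intro!: continuous_intros)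

lemma integrable_bump_shift: "0 < p \<Longrightarrow> integrable lborel (radial p (\<lambda>t. bump (t + a)))"
  by (rule integrable_radial[OF _ continuous_on_bump_shift bump_shift_support])

lemma radial_diff: "radial p (\<lambda>t. h t - h' t) x = radial p h x - radial p h' x"
  by (simp add: radial_def algebra_simps)

lemma radial_cmult: "radial p (\<lambda>t. c * h t) x = c * radial p h x"
  by (simp add: radial_def)

lemma radial_add: "radial p (\<lambda>t. h t + h' t) x = radial p h x + radial p h' x"
  by (simp add: radial_def algebra_simps)

lemma radial_mono: "(\<And>t. h t \<le> h' t) \<Longrightarrow> radial p h x \<le> radial p h' x"
  by (simp add: radial_def mult_left_mono)

text \<open>The difference of two translates of \<open>bump\<close> is the derivative of a
  difference of steps, which has compact support.\<close>

lemma \<Lambda>_bump_shift: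
  assumes p: "1 < p"
  shows "\<Lambda> p (\<lambda>t. bump (t + a)) = \<Lambda> p bump"
proof -
  have "((\<lambda>t. step (t + a) - step t) has_real_derivative bump (t + a) - bump t) (at t)" for t
  proof -
    have "((\<lambda>t. t + a) has_real_derivative 1) (at t)" by (auto intro!: derivative_eq_intros)
    from DERIV_diff[OF DERIV_chain2[OF step_derivative this] step_derivative] show ?thesis by simp
  qed
  moreover have "step (t + a) - step t = 0" if "t \<notin> {- (\<bar>a\<bar> + 1)..\<bar>a\<bar> + 1}" for t
    using that step_0[of t] step_0[of "t + a"] step_1[of t] step_1[of "t + a"]
    by (auto simp: not_le)
  ultimately have "\<Lambda> p (\<lambda>t. bump (t + a) - bump t) = 0"
    by (intro \<Lambda>_derivative[OF p, of "\<lambda>t. step (t + a) - step t" _ "\<bar>a\<bar> + 1"])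
       (auto intro!: continuous_intros continuous_on_bump_shift continuous_on_bump)
  then show ?thesis
    using integrable_bump_shift[of p a] integrable_bump_shift[of p 0] p
    by (simp add: \<Lambda>_def radial_diff)
qed

text \<open>By shift invariance \<open>bump\<close> may be moved so that it is positive at
  \<open>ln (N y)\<close> for a point y with nonzero gradient; there the continuous integrand is
  positive.\<close>

lemma \<Lambda>_bump_pos:
  assumes p: "1 < p"
  shows "0 < \<Lambda> p bump"
proof -
  obtain y where y: "y \<noteq> 0" "0 < g y" by (rule grad_N_nonzero)
  obtain z where z: "0 < bump z" by (rule bump_positive)
  define a where "a = z - ln (N y)"
  let ?h = "\<lambda>t. bump (t + a)"
  have "0 < (LINT x|lborel. radial p ?h x)"
  proof (rule integral_pos_continuous)
    have "Ck_on 0 UNIV (radial p ?h)"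
    proof (rule Ck_on_extend_zero[OF open_punctured shell])
      show "Ck_on 0 (- {0}) (radial p ?h)"
        using continuous_on_radial[OF _ continuous_on_bump_shift, of p a] p by simp
      show "radial p ?h x = 0" if "x \<notin> shell (\<bar>a\<bar> + 1)" for x
        using radial_zero[OF bump_shift_support that] .
    qed
    then show "continuous_on UNIV (radial p ?h)" by simp
    show "integrable lborel (radial p ?h)" using integrable_bump_shift p by simp
    show "0 \<le> radial p ?h x" for x by (simp add: radial_def bump_nonneg)
    show "0 < radial p ?h y"
      using y z N_pos[OF y(1)] by (simp add: radial_def a_def)
  qed
  then show ?thesis using \<Lambda>_bump_shift[OF p, of a] by (simp add: \<Lambda>_def)
qed

end

text \<open>Equal to 1 on [1-n, n] when n is at least 1, and 0 outside [-n, n+1]. Its derivative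
  lives on the two unit intervals at the ends.\<close>

definition plateau :: "nat \<Rightarrow> real \<Rightarrow> real" where
  "plateau n t = step (t + real n) - step (t - real n)"

lemma plateau_derivative:
  "(plateau n has_real_derivative bump (t + real n) - bump (t - real n)) (at t)"
proof -
  have "((\<lambda>t. t + a) has_real_derivative 1) (at t)" for a by (auto intro!: derivative_eq_intros)
  note d = DERIV_chain2[OF step_derivative this]
  from DERIV_diff[OF d[of "real n"] d[of "- real n"]] show ?thesis
    by (simp add: plateau_def[abs_def])
qed

lemma Ck_on_plateau: "Ck_on l UNIV (plateau n)"
  using Ck_on_diff[OF open_UNIV Ck_on_step[of l "real n"] Ck_on_step[of l "- real n"]]
  by (simp add: plateau_def[abs_def])

lemma plateau_range: "0 \<le> plateau n t" "plateau n t \<le> 1"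
  using step_mono[of "t - real n" "t + real n"] step_range[of "t + real n"] step_range[of "t - real n"]
  by (auto simp: plateau_def)

lemma plateau_support: "t \<notin> {- (real n + 1)..real n + 1} \<Longrightarrow> plateau n t = 0"
  using step_0[of "t + real n"] step_0[of "t - real n"] step_1[of "t + real n"] step_1[of "t - real n"]
  by (auto simp: plateau_def)

lemma plateau_1: "0 \<le> t \<Longrightarrow> t \<le> real n \<Longrightarrow> 1 \<le> n \<Longrightarrow> plateau n t = 1"
  by (simp add: plateau_def step_0 step_1)

section \<open>Truncated extremals and the sharp constant\<close>

context polarizable_carnot
begin

text \<open>In the variable \<open>t = ln N\<close> these truncate the virtual extremal \<open>N\<^bsup>-c\<^esup>\<close>, \<open>c = (Q - p)/p\<close>.\<close>

definition cutoff :: "real \<Rightarrow> nat \<Rightarrow> real^'n \<Rightarrow> real" where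
  "cutoff c n x = (if x = 0 then 0 else exp (- c * ln (N x)) * plateau n (ln (N x)))"

lemma cutoff_outside: "x \<notin> shell (real n + 1) \<Longrightarrow> cutoff c n x = 0"
  using shell_outside[of x "real n + 1"] plateau_support[of "ln (N x)" n]
  by (auto simp: cutoff_def)

lemma test_function_cutoff: "test_function (- {0}) (cutoff c n)"
proof -
  let ?F = "\<lambda>t. exp (- c * t) * plateau n t"
  have lnN: "Ck_on l (- {0}) (\<lambda>x. ln (N x))" for l
    by (rule Ck_on_compose[OF open_punctured _ Ck_on_N Ck_on_ln]) (simp add: N_pos)
  have "Ck_on l UNIV ?F" for l
    by (rule Ck_on_mult[OF open_UNIV Ck_on_exp Ck_on_plateau])
  then have "Ck_on l (- {0}) (\<lambda>x. ?F (ln (N x)))" for l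
    by (rule Ck_on_compose[OF open_punctured UNIV_I lnN])
  then have "Ck_on l (- {0}) (cutoff c n)" for l
    using Ck_on_cong[OF open_punctured, of "cutoff c n" "\<lambda>x. ?F (ln (N x))" l] by (simp add: cutoff_def)
  then have "Ck_on l UNIV (cutoff c n)" for l
    by (rule Ck_on_extend_zero[OF open_punctured shell _ cutoff_outside])
  moreover have sub: "closure {x. cutoff c n x \<noteq> 0} \<subseteq> shell (real n + 1)"
    using cutoff_outside by (intro closure_minimal compact_imp_closed shell) auto
  moreover have "compact (closure {x. cutoff c n x \<noteq> 0})"
    using bounded_subset[OF compact_imp_bounded[OF shell(1)] sub] by (simp add: compact_eq_bounded_closed)
  ultimately show ?thesis
    unfolding test_function_def smooth_on_def using shell(2)[of "real n + 1"] by blast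
qed

lemma grad_cutoff:
  assumes "x \<noteq> 0"
  defines "t \<equiv> ln (N x)"
  shows "norm (grad (cutoff c n) x)
    = exp (- c * t) * \<bar>bump (t + real n) - bump (t - real n) - c * plateau n t\<bar> / N x * g x"
proof -
  let ?F = "\<lambda>t. exp (- c * t) * plateau n t"
  let ?d = "bump (t + real n) - bump (t - real n) - c * plateau n t"
  have Np: "0 < N x" using N_pos[OF assms(1)] .
  have "((\<lambda>t. exp (- c * t)) has_real_derivative exp (- c * t) * (- c)) (at t)"
    by (auto intro!: derivative_eq_intros)
  from DERIV_mult[OF this plateau_derivative[of n t]]
  have "(?F has_real_derivative exp (- c * t) * ?d) (at t)"
    by (simp add: algebra_simps)
  then have "((\<lambda>r. ?F (ln r)) has_real_derivative exp (- c * t) * ?d * (1 / N x)) (at (N x))"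
    unfolding t_def by (rule DERIV_chain2[OF _ DERIV_ln_divide[OF Np]])
  from grad_compose[OF N_differentiable[OF assms(1)] this]
  have "grad (\<lambda>x. ?F (ln (N x))) x = (exp (- c * t) * ?d * (1 / N x)) *\<^sub>R grad N x" .
  moreover have "grad (cutoff c n) x = grad (\<lambda>x. ?F (ln (N x))) x"
  proof -
    have "cutoff c n differentiable (at x)"
      using test_function_cutoff[of c n]
      by (auto simp: test_function_def smooth_on_def simp del: Ck_on.simps intro: Ck_on_differentiable[of 0 UNIV])
    then have "X i (cutoff c n) x = X i (\<lambda>x. ?F (ln (N x))) x" for i
      by (rule vf_apply_cong[OF open_punctured, rotated 2]) (use assms(1) in \<open>auto simp: cutoff_def\<close>)
    then show ?thesis by (simp add: vec_eq_iff hgrad_def)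
  qed
  ultimately show ?thesis using Np by (simp add: abs_mult)
qed

text \<open>Inserting \<open>cutoff c n\<close> bounds (C - c^p) times a quantity growing linearly
  in n by a constant independent of n.\<close>

theorem hardy_sharp:
  assumes p: "1 < p" "p < real Q"
    and C: "\<And>\<phi>. test_function (- {0}) \<phi> \<Longrightarrow>
      C * (LINT x|lborel. g x powr p / N x powr p * \<bar>\<phi> x\<bar> powr p) \<le> (LINT x|lborel. norm (grad \<phi> x) powr p)"
  shows "C \<le> ((real Q - p) / p) powr p"
proof (rule ccontr)
  define c where "c = (real Q - p) / p"
  assume "\<not> C \<le> ((real Q - p) / p) powr p"
  then have gap: "0 < C - c powr p" by (simp add: c_def)
  have c: "0 < c" using p by (simp add: c_def)
  have cp: "c * p + p = real Q" using p by (simp add: c_def)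
  have p0: "0 < p" using p by simp
  obtain B where B: "0 < B" "\<And>t. bump t \<le> B" using bump_bounded by blast
  \<comment> \<open>Bounds |plateau' - c plateau|, because two values of \<open>bump\<close> differ
    by at most B and the plateau lies between 0 and 1.\<close>
  define R where "R = c + B"
  define M where "M = p * R powr (p - 1)"
  have M: "0 \<le> M" using p by (simp add: M_def)
  let ?m = "\<Lambda> p bump"
  have growth: "(C - c powr p) * (real n * ?m) \<le> B * (2 * M * ?m)" if n: "1 \<le> n" for n
  proof -
    define hA where "hA t = plateau n t powr p" for t
    define hB where "hB t = \<bar>bump (t + real n) - bump (t - real n) - c * plateau n t\<bar> powr p" for t
    \<comment> \<open>The error at the two ends of the plateau; by shift invariance
      \<open>\<Lambda>\<close> of it does not depend on n.\<close>
    define hE where "hE t = bump (t + real n) + bump (t + (- real n))" for t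
    \<comment> \<open>A row of n unit translates, whose \<open>\<Lambda>\<close> is exactly n times
      that of \<open>bump\<close>; it serves as a lower bound for the plateau.\<close>
    define hS where "hS t = (\<Sum>j<n. bump (t + (- real j)))" for t
    have shift_supp: "bump (t + a) = 0" if "t \<notin> {- (real n + 1)..real n + 1}" "\<bar>a\<bar> \<le> real n" for t a
      using that by (intro bump_shift_support) auto
    have cP: "continuous_on UNIV (plateau n)" using Ck_on_plateau[of 0] by simp
    have cb: "continuous_on UNIV (\<lambda>t. bump (t + real n))" "continuous_on UNIV (\<lambda>t. bump (t - real n))"
      using continuous_on_bump_shift[of "real n"] continuous_on_bump_shift[of "- real n"] by auto
    have cont: "continuous_on UNIV hA" "continuous_on UNIV hB"
      unfolding hA_def hB_def using p0 plateau_range(1)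
      by (intro continuous_on_powr' continuous_on_rabs continuous_on_diff continuous_on_mult_left
          continuous_on_const cP cb; simp)+
    have iA: "integrable lborel (radial p hA)"
      by (rule integrable_radial[OF p0 cont(1), of "real n + 1"]) (simp add: hA_def plateau_support)
    have iB: "integrable lborel (radial p hB)"
      by (rule integrable_radial[OF p0 cont(2), of "real n + 1"])
         (use shift_supp[of _ "real n"] shift_supp[of _ "- real n"] in \<open>simp add: hB_def plateau_support\<close>)
    have radial_E: "radial p hE x = radial p (\<lambda>t. bump (t + real n)) x + radial p (\<lambda>t. bump (t + (- real n))) x" for x
      by (simp add: hE_def[abs_def] radial_add)
    have radial_S: "radial p hS x = (\<Sum>j<n. radial p (\<lambda>t. bump (t + (- real j))) x)" for x
      by (simp add: hS_def radial_def sum_distrib_left)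
    have iE: "integrable lborel (radial p hE)"
      unfolding radial_E[abs_def] using integrable_bump_shift[OF p0] by (intro Bochner_Integration.integrable_add)
    have iS: "integrable lborel (radial p hS)"
      unfolding radial_S[abs_def] using integrable_bump_shift[OF p0] by (intro Bochner_Integration.integrable_sum)
    have E: "\<Lambda> p hE = 2 * ?m"
      using Bochner_Integration.integral_add[OF integrable_bump_shift[OF p0, of "real n"]
          integrable_bump_shift[OF p0, of "- real n"]]
      unfolding \<Lambda>_def[of p hE] radial_E
      by (simp only: \<Lambda>_def[symmetric] \<Lambda>_bump_shift[OF p(1)])
    have S: "\<Lambda> p hS = real n * ?m"
    proof -
      have "\<Lambda> p hS = (\<Sum>j<n. \<Lambda> p (\<lambda>t. bump (t + (- real j))))"
        unfolding \<Lambda>_def radial_S by (rule Bochner_Integration.integral_sum) (rule integrable_bump_shift[OF p0])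
      then show ?thesis unfolding \<Lambda>_bump_shift[OF p(1)] by simp
    qed
    \<comment> \<open>The n translates live on [0, n], where the plateau is 1 and their sum is at
      most B.\<close>
    have "hS t \<le> B * hA t" for t
    proof (cases "0 \<le> t \<and> t \<le> real n")
      case True
      then have "hA t = 1" using plateau_1 n by (simp add: hA_def)
      then show ?thesis using sum_bump_le[OF B(2,1), of t n] by (simp add: hS_def)
    next
      case False
      have "bump (t + (- real j)) = 0" if "j < n" for j
        using False that by (intro bump_0) auto
      then have "hS t = 0" by (simp add: hS_def)
      then show ?thesis using B(1) by (simp add: hA_def)
    qed
    then have "radial p hS x \<le> B * radial p hA x" for x
      unfolding radial_cmult[symmetric] by (rule radial_mono)
    then have "\<Lambda> p hS \<le> B * \<Lambda> p hA"
      unfolding \<Lambda>_def integral_mult_right_zero[symmetric]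
      using iS iA by (intro integral_mono) auto
    then have lower: "real n * ?m \<le> B * \<Lambda> p hA" unfolding S .
    have "hB t \<le> c powr p * hA t + M * hE t" for t
    proof -
      let ?b = "bump (t + real n) - bump (t - real n)"
      have b: "0 \<le> bump (t + real n)" "bump (t + real n) \<le> B" "0 \<le> bump (t - real n)" "bump (t - real n) \<le> B"
        using bump_nonneg B(2) by auto
      have P: "0 \<le> c * plateau n t" "c * plateau n t \<le> c"
        using plateau_range[of n t] c mult_left_le[of "plateau n t" c] by auto
      have R: "\<bar>?b - c * plateau n t\<bar> \<le> R" "\<bar>- (c * plateau n t)\<bar> \<le> R"
        using b P B(1) by (simp_all only: R_def abs_le_iff) linarith+
      \<comment> \<open>The plateau derivative is treated as a perturbation of -c plateau; its
        absolute value is at most \<open>hE t\<close>.\<close>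
      have "hB t \<le> \<bar>- (c * plateau n t)\<bar> powr p + p * R powr (p - 1) * \<bar>?b - c * plateau n t - (- (c * plateau n t))\<bar>"
        unfolding hB_def by (rule abs_powr_lipschitz[OF p(1) R])
      also have "\<bar>- (c * plateau n t)\<bar> powr p = c powr p * hA t"
        using c plateau_range(1)[of n t] by (simp add: hA_def abs_mult powr_mult)
      also have "p * R powr (p - 1) * \<bar>?b - c * plateau n t - (- (c * plateau n t))\<bar> \<le> M * hE t"
        unfolding M_def[symmetric] using b M by (intro mult_left_mono) (auto simp: hE_def abs_le_iff)
      finally show ?thesis by simp
    qed
    then have "radial p hB x \<le> radial p (\<lambda>t. c powr p * hA t + M * hE t) x" for x
      by (rule radial_mono)
    then have "\<Lambda> p hB \<le> (LINT x|lborel. c powr p * radial p hA x + M * radial p hE x)"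
      unfolding \<Lambda>_def radial_add radial_cmult using iA iB iE by (intro integral_mono) auto
    also have "\<dots> = c powr p * \<Lambda> p hA + M * \<Lambda> p hE"
      unfolding \<Lambda>_def using iA iE by simp
    finally have upper: "\<Lambda> p hB \<le> c powr p * \<Lambda> p hA + 2 * M * ?m" by (simp add: E)
    have A_eq: "g x powr p / N x powr p * \<bar>cutoff c n x\<bar> powr p = radial p hA x"
      and B_eq: "norm (grad (cutoff c n) x) powr p = radial p hB x" for x
    proof -
      consider "x = 0" | "x \<noteq> 0" by blast
      then have "g x powr p / N x powr p * \<bar>cutoff c n x\<bar> powr p = radial p hA x
          \<and> norm (grad (cutoff c n) x) powr p = radial p hB x"
      proof cases
        case 1
        have "0 \<notin> shell (real n + 1)" using shell(2) by auto
        have "grad (cutoff c n) 0 = 0"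
          by (rule grad_zero_outside[OF compact_imp_closed[OF shell(1)] cutoff_outside \<open>0 \<notin> shell (real n + 1)\<close>])
        then show ?thesis using 1 by (simp add: radial_def cutoff_def)
      next
        case 2
        let ?t = "ln (N x)"
        have Np: "0 < N x" using N_pos[OF 2] .
        have e: "exp (- c * ?t) = N x powr (- c)" using 2 by (simp add: powr_def)
        \<comment> \<open>Since c p + p = Q, the extremal power and the Hardy weight combine to the
          density N^(-Q) of \<open>radial\<close>, so both integrals become values of
          \<open>\<Lambda>\<close>.\<close>
        have pw: "(N x powr (- c)) powr p * (1 / N x powr p) = N x powr (- real Q)"
        proof -
          have "- c * p - p = - real Q" using cp by simp
          then have "N x powr (- c * p - p) = N x powr (- real Q)" by simp
          then show ?thesis by (simp add: powr_powr powr_diff)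
        qed
        have "g x powr p / N x powr p * \<bar>cutoff c n x\<bar> powr p
            = g x powr p * ((N x powr (- c)) powr p * (1 / N x powr p)) * plateau n ?t powr p"
          using 2 plateau_range(1)[of n ?t] unfolding cutoff_def e by (simp add: abs_mult powr_mult)
        moreover have "norm (grad (cutoff c n) x) powr p
            = g x powr p * ((N x powr (- c)) powr p * (1 / N x powr p))
              * \<bar>bump (?t + real n) - bump (?t - real n) - c * plateau n ?t\<bar> powr p"
          unfolding grad_cutoff[OF 2] e using Np by (simp add: powr_mult powr_divide)
        ultimately show ?thesis unfolding pw radial_def hA_def hB_def by simp
      qed
      then show "g x powr p / N x powr p * \<bar>cutoff c n x\<bar> powr p = radial p hA x"
        "norm (grad (cutoff c n) x) powr p = radial p hB x" by auto
    qed
    have "C * \<Lambda> p hA \<le> \<Lambda> p hB"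
      using C[OF test_function_cutoff[of c n]] unfolding A_eq B_eq \<Lambda>_def .
    with upper have "(C - c powr p) * \<Lambda> p hA \<le> 2 * M * ?m" by (simp add: algebra_simps)
    then have "B * ((C - c powr p) * \<Lambda> p hA) \<le> B * (2 * M * ?m)"
      using B(1) by (intro mult_left_mono) auto
    moreover have "(C - c powr p) * (real n * ?m) \<le> (C - c powr p) * (B * \<Lambda> p hA)"
      using lower gap by (intro mult_left_mono) auto
    ultimately show ?thesis by (simp only: mult_ac)
  qed
  have pos: "0 < (C - c powr p) * ?m" using gap \<Lambda>_bump_pos[OF p(1)] by simp
  obtain n :: nat where "B * (2 * M * ?m) / ((C - c powr p) * ?m) < real n"
    using reals_Archimedean2 by blast
  \<comment> \<open>Passing to the successor meets the condition \<open>1 \<le> n\<close> of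
    \<open>growth\<close>.\<close>
  then have "B * (2 * M * ?m) < real (Suc n) * ((C - c powr p) * ?m)"
    using pos by (simp add: divide_less_eq algebra_simps)
  with growth[of "Suc n"] show False by (simp add: mult_ac)
qed

end

theorem theorem3p1:
  fixes gmul :: "real^'n::finite \<Rightarrow> real^'n \<Rightarrow> real^'n" and ginv :: "real^'n \<Rightarrow> real^'n"
    and \<alpha> :: "'n \<Rightarrow> nat" and k Q :: nat
    and u N :: "real^'n \<Rightarrow> real" and p :: real
  assumes "carnot_group gmul ginv \<alpha> k"
    and "Q = homogeneous_dimension \<alpha> k" and "3 \<le> Q"
    and "folland_solution gmul ginv \<alpha> Q u"
    and "N = norm_of Q u"
    and "polarizable gmul \<alpha> N"
    and "1 < p" and "p < real Q"
  shows "(\<forall>\<phi>. test_function (- {0}) \<phi> \<longrightarrow>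
            (LINT x|lborel. norm (hgrad gmul \<alpha> \<phi> x) powr p)
            \<ge> ((real Q - p) / p) powr p *
               (LINT x|lborel. norm (hgrad gmul \<alpha> N x) powr p / N x powr p * \<bar>\<phi> x\<bar> powr p))
       \<and> (\<forall>C. (\<forall>\<phi>. test_function (- {0}) \<phi> \<longrightarrow>
            (LINT x|lborel. norm (hgrad gmul \<alpha> \<phi> x) powr p)
            \<ge> C * (LINT x|lborel. norm (hgrad gmul \<alpha> N x) powr p / N x powr p * \<bar>\<phi> x\<bar> powr p))
          \<longrightarrow> C \<le> ((real Q - p) / p) powr p)"
proof -
  interpret carnot_group gmul ginv \<alpha> k by fact
  interpret polarizable_carnot gmul ginv \<alpha> k Q u N
    by unfold_locales fact+
  show ?thesis using hardy[OF assms(7,8)] hardy_sharp[OF assms(7,8)] by blast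
qed

end
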